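(* Let $G=(V,E)$ be a finite graph with at least one edge and with linear-width bounded by $\ell$, let $p\in(0,1)$ and let $q\ge1$ be a natural number. Let $P_{\rm SW}$ and $P_{\rm SB}$ be the transition matrices of the Swendsen-Wang and (lazy) single-bond dynamics for the random-cluster model on $G$ with parameters $p$ and $q$. Then $$\lambda(P_{\rm SW})^{-1}\;\le\;\lambda(P_{\rm SB})^{-1}\;\le\;4|E|^2\,q^{\ell+1},$$ where $\lambda(\cdot)$ denotes the spectral gap.
   Context: The linear-width of a graph $G=(V,E)$ is the smallest number $\ell$ such that there exists an ordering $e_1,\dots,e_{|E|}$ of the edges with the property that for every $i\in\{1,\dots,|E|\}$ there are at most $\ell$ vertices that are incident both to an edge in $\{e_1,\dots,e_i\}$ and to an edge in $\{e_{i+1},\dots,e_{|E|}\}$. The random-cluster model on $G$ with parameters $p,q$ has state space $\Omega_{\rm RC}=\{A: A\subseteq E\}$ and probability measure $\mu(A)=\frac1Z\left(\frac{p}{1-p}\right)^{|A|}q^{c(A)}$, where $c(A)$ is the number of connected components of $(V,A)$ (isolated vertices count as components) and $Z$ is the normalizing constant. Let $\Omega_{\rm P}=\{1,\dots,q\}^V$. For $A\subseteq E$ let $\Omega(A)=\{\sigma\in\Omega_{\rm P}:\sigma(u)=\sigma(v)\text{ for all }\{u,v\}\in A\}$, and for $\sigma\in\Omega_{\rm P}$ let $E(\sigma)=\{\{u,v\}\in E:\sigma(u)=\sigma(v)\}$. Write $\mathbf 1(\cdot)$ for the indicator. Swendsen-Wang dynamics (on $\Omega_{\rm RC}$): for $A,B\subseteq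 E$, $$P_{\rm SW}(A,B)=q^{-c(A)}\left(\frac{p}{1-p}\right)^{|B|}\sum_{\sigma\in\Omega_{\rm P}}(1-p)^{|E(\sigma)|}\,\mathbf 1\bigl(\sigma\in\Omega(A\cup B)\bigr).$$ That is: given $A$, color each connected component of $(V,A)$ independently and uniformly with a color in $\{1,\dots,q\}$, obtaining $\sigma$; then keep each edge of $E(\sigma)$ independently with probability $p$ to obtain $B$. Single-bond dynamics (on $\Omega_{\rm RC}$): $P_{\rm SB}(A,B)=\frac12\mathbf 1(A=B)+\frac1{2|E|}\sum_{e\in E}P_e(A,B)$, where for $e=\{e_1,e_2\}$, $P_e(A,B)=0$ unless the symmetric difference of $A$ and $B$ is contained in $\{e\}$, in which case $P_e(A,B)=p^{|B\cap\{e\}|}(1-p)^{1-|B\cap\{e\}|}$ if $e_1,e_2$ are connected in $(V,A)$, and $P_e(A,B)=\left(\frac pq\right)^{|B\cap\{e\}|}\left(1-\frac pq\right)^{1-|B\cap\{e\}|}$ if they are not connected in $(V,A)$. Both chains are ergodic and reversible with respect to $\mu$. The spectral gap of an ergodic reversible transition matrix $P$ is $\lambda(P)=1-\max\{|\xi|:\xi\text{ is an eigenvalue of }P,\ \xi\ne1\}$. *)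

theory Defs
  imports Complex_Main "HOL-Library.FuncSet" "HOL-Library.Extended_Real"
begin

definition finite_graph :: "'v set \<Rightarrow> 'v set set \<Rightarrow> bool" where
  "finite_graph V E \<longleftrightarrow> finite V \<and> (\<forall>e\<in>E. e \<subseteq> V \<and> card e = 2)"

definition edge_ordering :: "'v set set \<Rightarrow> 'v set list \<Rightarrow> bool" where
  "edge_ordering E es \<longleftrightarrow> distinct es \<and> set es = E"

definition cut_vertices :: "'v set \<Rightarrow> 'v set list \<Rightarrow> nat \<Rightarrow> 'v set" where
  "cut_vertices V es i =
     {v\<in>V. (\<exists>e\<in>set (take i es). v \<in> e) \<and> (\<exists>e\<in>set (drop i es). v \<in> e)}"

definition linear_width :: "'v set \<Rightarrow> 'v set set \<Rightarrow> nat" where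
  "linear_width V E =
     (LEAST l. \<exists>es. edge_ordering E es \<and> (\<forall>i\<in>{1..card E}. card (cut_vertices V es i) \<le> l))"

definition connection :: "'v set \<Rightarrow> 'v set set \<Rightarrow> ('v \<times> 'v) set" where
  "connection V A = {(u, v). {u, v} \<in> A}\<^sup>* \<inter> V \<times> V"

definition num_components :: "'v set \<Rightarrow> 'v set set \<Rightarrow> nat" where
  "num_components V A = card (V // connection V A)"

definition rc_states :: "'v set set \<Rightarrow> 'v set set set" where
  "rc_states E = Pow E"

text \<open>Extensional functions, so that a colouring is determined by its values on \<open>V\<close>.\<close>

definition potts_states :: "'v set \<Rightarrow> nat \<Rightarrow> ('v \<Rightarrow> nat) set" where
  "potts_states V q = V \<rightarrow>\<^sub>E {1..q}"

definition compatible_colourings :: "'v set \<Rightarrow> nat \<Rightarrow> 'v set set \<Rightarrow> ('v \<Rightarrow> nat) set" where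
  "compatible_colourings V q A = {\<sigma>\<in>potts_states V q. \<forall>u v. {u, v} \<in> A \<longrightarrow> \<sigma> u = \<sigma> v}"

definition mono_edges :: "'v set set \<Rightarrow> ('v \<Rightarrow> nat) \<Rightarrow> 'v set set" where
  "mono_edges E \<sigma> = {{u, v} | u v. {u, v} \<in> E \<and> \<sigma> u = \<sigma> v}"

text \<open>Transition matrices are real-valued kernels; only their entries on \<^term>\<open>rc_states E\<close> matter.\<close>

definition swendsen_wang ::
  "'v set \<Rightarrow> 'v set set \<Rightarrow> real \<Rightarrow> nat \<Rightarrow> 'v set set \<Rightarrow> 'v set set \<Rightarrow> real" where
  "swendsen_wang V E p q A B =
     inverse (real q ^ num_components V A) * (p / (1 - p)) ^ card B *
     (\<Sum>\<sigma>\<in>potts_states V q.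
        (1 - p) ^ card (mono_edges E \<sigma>) * of_bool (\<sigma> \<in> compatible_colourings V q (A \<union> B)))"

text \<open>The endpoints of \<open>e\<close> are connected in the configuration \<open>A\<close>, which may itself contain \<open>e\<close>.\<close>

definition endpoints_connected :: "'v set \<Rightarrow> 'v set set \<Rightarrow> 'v set \<Rightarrow> bool" where
  "endpoints_connected V A e \<longleftrightarrow> (\<forall>u\<in>e. \<forall>v\<in>e. (u, v) \<in> connection V A)"

definition edge_update ::
  "'v set \<Rightarrow> real \<Rightarrow> nat \<Rightarrow> 'v set \<Rightarrow> 'v set set \<Rightarrow> 'v set set \<Rightarrow> real" where
  "edge_update V p q e A B =
     (if (A - B) \<union> (B - A) \<subseteq> {e}
      then let r = (if endpoints_connected V A e then p else p / real q)
           in r ^ card (B \<inter> {e}) * (1 - r) ^ (1 - card (B \<inter> {e}))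
      else 0)"

definition single_bond ::
  "'v set \<Rightarrow> 'v set set \<Rightarrow> real \<Rightarrow> nat \<Rightarrow> 'v set set \<Rightarrow> 'v set set \<Rightarrow> real" where
  "single_bond V E p q A B =
     1 / 2 * of_bool (A = B) + 1 / (2 * real (card E)) * (\<Sum>e\<in>E. edge_update V p q e A B)"

definition is_eigenvalue :: "'s set \<Rightarrow> ('s \<Rightarrow> 's \<Rightarrow> real) \<Rightarrow> complex \<Rightarrow> bool" where
  "is_eigenvalue S P \<xi> \<longleftrightarrow>
     (\<exists>f :: 's \<Rightarrow> complex. (\<exists>x\<in>S. f x \<noteq> 0) \<and>
        (\<forall>x\<in>S. (\<Sum>y\<in>S. of_real (P x y) * f y) = \<xi> * f x))"

text \<open>
  Intended for ergodic reversible \<open>P\<close> on a finite \<open>S\<close> with at least two elements, where the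
  set under \<^const>\<open>Max\<close> is finite and nonempty.
\<close>

definition spectral_gap :: "'s set \<Rightarrow> ('s \<Rightarrow> 's \<Rightarrow> real) \<Rightarrow> real" where
  "spectral_gap S P = 1 - Max {cmod \<xi> | \<xi>. is_eigenvalue S P \<xi> \<and> \<xi> \<noteq> 1}"

text \<open>
  Inverse gaps are taken in \<^typ>\<open>ereal\<close>, where the inverse of \<open>0\<close> is \<open>\<infinity>\<close> rather than \<open>0\<close>, so that
  a finite upper bound on an inverse gap does rule out a vanishing gap.
\<close>

definition inverse_gap :: "'s set \<Rightarrow> ('s \<Rightarrow> 's \<Rightarrow> real) \<Rightarrow> ereal" where
  "inverse_gap S P = inverse (ereal (spectral_gap S P))"

end

theory Submission
  imports Defs "HOL-Analysis.Function_Topology" "HOL-Analysis.Convex"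
    "Jordan_Normal_Form.Spectral_Radius"
begin

text \<open>
  Both chains are reversible with respect to the weight
  \<open>w(A) = (p / (1 - p)) ^ |A| * q ^ c(A)\<close>, where \<open>q ^ c(A)\<close> is the number of colourings
  compatible with \<open>A\<close>. For a reversible chain with nonnegative spectrum the gap is
  \<open>1 - \<beta>\<close>, with \<open>\<beta>\<close> the maximum of \<open>\<langle>f, P f\<rangle> / \<langle>f, f\<rangle>\<close> over \<open>f\<close> orthogonal to the constants;
  the maximum is attained by compactness, at an eigenfunction. Hence the gaps can be
  compared through the quadratic forms (\<open>spectral_gap_rayleigh\<close>).

  \<^bold>\<open>First inequality.\<close> Condition on the colouring \<open>\<sigma>\<close>. One Swendsen-Wang step resamples all
  monochromatic edges of \<open>\<sigma>\<close>, an edge update resamples only one of them, and both are averages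
  over \<open>\<sigma>\<close> of such resamplings. Resampling everything is an orthogonal projection onto a smaller
  space than resampling one edge, so by Cauchy-Schwarz
  \<open>0 \<le> \<langle>f, P\<^sub>S\<^sub>W f\<rangle> \<le> \<langle>f, P\<^sub>e f\<rangle> \<le> \<langle>f, f\<rangle>\<close> for every edge \<open>e\<close>
  (\<open>inner_SW_le_inner_update\<close>). Averaging over \<open>e\<close> and with the identity gives
  \<open>P\<^sub>S\<^sub>W \<le> P\<^sub>S\<^sub>B\<close> as forms.

  \<^bold>\<open>Second inequality.\<close> Order the edges with small cuts and move from \<open>X\<close> to \<open>Y\<close> by changing the
  edges one at a time in this order. After \<open>i\<close> steps the path is at \<open>Z\<close>, which agrees with \<open>Y\<close> on
  the first \<open>i\<close> edges and with \<open>X\<close> on the others; let \<open>W\<close> be the complementary configuration.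
  Then \<open>(X, Y) \<mapsto> (Z, W)\<close> is an involution, and \<open>w(X) * w(Y) \<le> q ^ l * w(Z) * w(W)\<close>
  (\<open>weight_swap\<close>). For the latter it suffices to compare numbers of pairs of colourings: pairs
  \<open>(\<sigma>, \<tau>)\<close> compatible with \<open>(X, Y)\<close> are classified by \<open>\<sigma> - \<tau>\<close> modulo \<open>q\<close> on the at most \<open>l\<close> cut
  vertices; the differences of two pairs in one class agree on the cut, so they can be cut and
  glued to a pair compatible with \<open>(Z, W)\<close>. Summing over \<open>W\<close> costs one more factor \<open>q\<close>, by which the
  marginal law of an edge is compared with the update probability (\<open>resampled_edge_bound\<close>). This
  gives \<open>\<langle>f, f\<rangle> \<le> 2 |E|\<^sup>2 q ^ (l + 1) \<langle>f, f - P\<^sub>S\<^sub>B f\<rangle>\<close> for \<open>f\<close> orthogonal to the constants.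
\<close>

section \<open>Reversible kernels and the Rayleigh quotient\<close>

text \<open>The bilinear form of \<open>L\<^sup>2(S, w)\<close>; the weight \<open>w\<close> is not normalised.\<close>

definition weighted_inner :: "'s set \<Rightarrow> ('s \<Rightarrow> real) \<Rightarrow> ('s \<Rightarrow> real) \<Rightarrow> ('s \<Rightarrow> real) \<Rightarrow> real" where
  "weighted_inner S w f g = (\<Sum>x\<in>S. w x * f x * g x)"

text \<open>The operator \<open>f \<mapsto> P f\<close> on functions on \<open>S\<close>.\<close>

definition kernel_apply :: "'s set \<Rightarrow> ('s \<Rightarrow> 's \<Rightarrow> real) \<Rightarrow> ('s \<Rightarrow> real) \<Rightarrow> 's \<Rightarrow> real" where
  "kernel_apply S P f x = (\<Sum>y\<in>S. P x y * f y)"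

lemma weighted_inner_linear:
  "weighted_inner S w f (\<lambda>x. a * g x + b * h x) = a * weighted_inner S w f g + b * weighted_inner S w f h"
  "weighted_inner S w (\<lambda>x. a * g x + b * h x) f = a * weighted_inner S w g f + b * weighted_inner S w h f"
  by (simp_all add: weighted_inner_def sum.distrib sum_distrib_left algebra_simps)

lemma weighted_inner_commute: "weighted_inner S w f g = weighted_inner S w g f"
  by (simp add: weighted_inner_def mult_ac)

lemma kernel_apply_linear:
  "kernel_apply S P (\<lambda>x. a * g x + b * h x) x = a * kernel_apply S P g x + b * kernel_apply S P h x"
  by (simp add: kernel_apply_def sum.distrib sum_distrib_left algebra_simps)

text \<open>After an enumeration of \<open>S\<close>, the kernel becomes a complex matrix, whose spectrum is finite.\<close>

lemma finite_eigenvalues: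
  assumes "finite S"
  shows "finite {\<xi>. is_eigenvalue S P \<xi>}"
proof -
  obtain h where h: "bij_betw h {0..<card S} S"
    using assms ex_bij_betw_nat_finite by blast
  define A where "A = mat (card S) (card S) (\<lambda>(i, j). complex_of_real (P (h i) (h j)))"
  have A: "A \<in> carrier_mat (card S) (card S)" by (simp add: A_def)
  have "\<xi> \<in> spectrum A" if "is_eigenvalue S P \<xi>" for \<xi>
  proof -
    from that obtain f x where f: "\<And>x. x \<in> S \<Longrightarrow> (\<Sum>y\<in>S. of_real (P x y) * f y) = \<xi> * f x"
      and x: "x \<in> S" "f x \<noteq> 0"
      unfolding is_eigenvalue_def by blast
    define v where "v = vec (card S) (\<lambda>i. f (h i))"
    obtain i where i: "i < card S" "h i = x"
      using x(1) by (metis atLeastLessThan_iff bij_betw_imp_surj_on h imageE)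
    have "v $ i \<noteq> 0" using i x by (simp add: v_def)
    then have "v \<noteq> 0\<^sub>v (card S)" using i by auto
    moreover have "A *\<^sub>v v = \<xi> \<cdot>\<^sub>v v"
    proof (rule eq_vecI)
      fix i assume "i < dim_vec (\<xi> \<cdot>\<^sub>v v)"
      then have i: "i < card S" by (simp add: v_def)
      then have hi: "h i \<in> S" using h by (auto simp: bij_betw_def)
      have "(A *\<^sub>v v) $ i = (\<Sum>j = 0..<card S. of_real (P (h i) (h j)) * f (h j))"
        using i by (simp add: A_def v_def scalar_prod_def)
      also have "\<dots> = (\<Sum>y\<in>S. of_real (P (h i) y) * f y)"
        by (rule sum.reindex_bij_betw[OF h])
      finally show "(A *\<^sub>v v) $ i = (\<xi> \<cdot>\<^sub>v v) $ i"
        using f[OF hi] i by (simp add: v_def)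
    qed (simp add: A_def v_def)
    ultimately show ?thesis
      by (auto simp: spectrum_def eigenvalue_def eigenvector_def v_def A_def intro!: exI[of _ v])
  qed
  then have "{\<xi>. is_eigenvalue S P \<xi>} \<subseteq> spectrum A" by blast
  then show ?thesis using card_finite_spectrum(1)[OF A] finite_subset by blast
qed

text \<open>A kernel on a finite set with row sums \<open>1\<close> that satisfies detailed balance with respect to a
  positive weight. Its entries need not be nonnegative.\<close>

locale reversible_kernel =
  fixes S :: "'s set" and w :: "'s \<Rightarrow> real" and P :: "'s \<Rightarrow> 's \<Rightarrow> real"
  assumes finite_S: "finite S"
    and w_pos: "x \<in> S \<Longrightarrow> 0 < w x"
    and balance: "x \<in> S \<Longrightarrow> y \<in> S \<Longrightarrow> w x * P x y = w y * P y x"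
    and row_sum: "x \<in> S \<Longrightarrow> (\<Sum>y\<in>S. P x y) = 1"
begin

abbreviation inner_w where "inner_w \<equiv> weighted_inner S w"
abbreviation app where "app \<equiv> kernel_apply S P"

lemma inner_self_nonneg: "0 \<le> inner_w f f"
  unfolding weighted_inner_def
  by (intro sum_nonneg) (metis less_imp_le mult.assoc mult_nonneg_nonneg w_pos zero_le_square)

lemma inner_self_pos:
  assumes "x \<in> S" "f x \<noteq> 0" shows "0 < inner_w f f"
  unfolding weighted_inner_def
proof (rule sum_pos2[OF finite_S assms(1)])
  show "0 < w x * f x * f x" using w_pos[OF assms(1)] assms(2)
    by (simp add: mult.assoc power2_eq_square[symmetric])
  show "0 \<le> w i * f i * f i" if "i \<in> S" for i
    using w_pos[OF that] by (simp add: mult.assoc)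
qed

lemma inner_self_eq_0: "inner_w f f = 0 \<Longrightarrow> x \<in> S \<Longrightarrow> f x = 0"
  using inner_self_pos by force

lemma app_symmetric: "inner_w f (app g) = inner_w (app f) g"
proof -
  have "inner_w f (app g) = (\<Sum>x\<in>S. \<Sum>y\<in>S. (w x * P x y) * f x * g y)"
    by (simp add: weighted_inner_def kernel_apply_def sum_distrib_left mult_ac)
  also have "\<dots> = (\<Sum>x\<in>S. \<Sum>y\<in>S. (w y * P y x) * f x * g y)"
    by (intro sum.cong refl) (simp add: balance)
  also have "\<dots> = (\<Sum>y\<in>S. \<Sum>x\<in>S. (w y * P y x) * f x * g y)"
    by (rule sum.swap)
  also have "\<dots> = inner_w (app f) g"
    by (simp add: weighted_inner_def kernel_apply_def sum_distrib_left sum_distrib_right mult_ac)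
  finally show ?thesis .
qed

lemma app_const: "x \<in> S \<Longrightarrow> app (\<lambda>_. c) x = c"
  using row_sum by (simp add: kernel_apply_def flip: sum_distrib_right)

lemma inner_app_const: "inner_w (\<lambda>_. 1) (app f) = inner_w (\<lambda>_. 1) f"
  unfolding app_symmetric by (simp add: weighted_inner_def app_const)

text \<open>The Dirichlet form of the kernel as a sum over transitions.\<close>

lemma dirichlet_form:
  "inner_w f f - inner_w f (app f) = 1 / 2 * (\<Sum>x\<in>S. \<Sum>y\<in>S. w x * P x y * (f x - f y)\<^sup>2)"
proof -
  have sq: "(\<Sum>x\<in>S. \<Sum>y\<in>S. w x * P x y * (f x)\<^sup>2) = inner_w f f"
  proof -
    have "(\<Sum>y\<in>S. w x * P x y * (f x)\<^sup>2) = w x * f x * f x * (\<Sum>y\<in>S. P x y)" for x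
      by (simp add: sum_distrib_left power2_eq_square mult_ac)
    then show ?thesis by (simp add: weighted_inner_def row_sum)
  qed
  have "(\<Sum>x\<in>S. \<Sum>y\<in>S. w x * P x y * (f y)\<^sup>2) = (\<Sum>x\<in>S. \<Sum>y\<in>S. w y * P y x * (f y)\<^sup>2)"
    by (intro sum.cong refl) (simp add: balance)
  also have "\<dots> = inner_w f f" using sq by (subst sum.swap)
  finally have sq': "(\<Sum>x\<in>S. \<Sum>y\<in>S. w x * P x y * (f y)\<^sup>2) = inner_w f f" .
  have "(\<Sum>x\<in>S. \<Sum>y\<in>S. w x * P x y * (f x - f y)\<^sup>2) = (\<Sum>x\<in>S. \<Sum>y\<in>S.
      w x * P x y * (f x)\<^sup>2 + w x * P x y * (f y)\<^sup>2 - 2 * (w x * f x * (P x y * f y)))"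
    by (intro sum.cong refl) (simp add: power2_diff algebra_simps)
  also have "\<dots> = (\<Sum>x\<in>S. \<Sum>y\<in>S. w x * P x y * (f x)\<^sup>2) + (\<Sum>x\<in>S. \<Sum>y\<in>S. w x * P x y * (f y)\<^sup>2)
      - 2 * (\<Sum>x\<in>S. \<Sum>y\<in>S. w x * f x * (P x y * f y))"
    by (simp only: sum.distrib sum_subtractf sum_distrib_left)
  also have "(\<Sum>x\<in>S. \<Sum>y\<in>S. w x * f x * (P x y * f y)) = inner_w f (app f)"
    by (simp add: weighted_inner_def kernel_apply_def sum_distrib_left)
  finally show ?thesis by (simp add: sq sq')
qed

lemma inner_app_le:
  assumes "\<And>x y. x \<in> S \<Longrightarrow> y \<in> S \<Longrightarrow> 0 \<le> P x y"
  shows "inner_w f (app f) \<le> inner_w f f"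
proof -
  have "0 \<le> (\<Sum>x\<in>S. \<Sum>y\<in>S. w x * P x y * (f x - f y)\<^sup>2)"
    by (intro sum_nonneg mult_nonneg_nonneg assms less_imp_le[OF w_pos]) auto
  then show ?thesis using dirichlet_form[of f] by linarith
qed

text \<open>The spectrum is real, since the kernel is symmetric for the weighted inner product, and the
  real and the imaginary part of an eigenfunction, not both zero, satisfy the eigenvalue equation too.\<close>

lemma real_eigenfunction:
  assumes "is_eigenvalue S P \<xi>"
  obtains c f x where "\<xi> = complex_of_real c" "x \<in> S" "f x \<noteq> 0" "\<And>x. x \<in> S \<Longrightarrow> app f x = c * f x"
proof -
  from assms obtain f x where f: "\<And>x. x \<in> S \<Longrightarrow> (\<Sum>y\<in>S. of_real (P x y) * f y) = \<xi> * f x"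
    and x: "x \<in> S" "f x \<noteq> 0"
    unfolding is_eigenvalue_def by blast
  define g where "g = (\<lambda>x. Re (f x))"
  define h where "h = (\<lambda>x. Im (f x))"
  have Re: "app g x = Re \<xi> * g x - Im \<xi> * h x" if "x \<in> S" for x
    using arg_cong[OF f[OF that], of Re] by (simp add: kernel_apply_def g_def h_def)
  have Im: "app h x = Re \<xi> * h x + Im \<xi> * g x" if "x \<in> S" for x
    using arg_cong[OF f[OF that], of Im] by (simp add: kernel_apply_def g_def h_def)
  \<comment> \<open>Comparing \<open>\<langle>h, P g\<rangle>\<close> with \<open>\<langle>P h, g\<rangle>\<close> leaves \<open>Im \<xi> * (\<langle>g, g\<rangle> + \<langle>h, h\<rangle>) = 0\<close>.\<close>
  have "inner_w h (app g) = inner_w h (\<lambda>x. Re \<xi> * g x + (- Im \<xi>) * h x)"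
    by (simp add: weighted_inner_def Re)
  moreover have "inner_w (app h) g = inner_w (\<lambda>x. Re \<xi> * h x + Im \<xi> * g x) g"
    by (simp add: weighted_inner_def Im)
  ultimately have "Im \<xi> * (inner_w g g + inner_w h h) = 0"
    using app_symmetric[of h g] unfolding weighted_inner_linear by (simp add: algebra_simps)
  moreover have "g x \<noteq> 0 \<or> h x \<noteq> 0"
    using x by (simp add: g_def h_def complex_eq_iff)
  then have "0 < inner_w g g + inner_w h h"
    using inner_self_pos[OF x(1)] inner_self_nonneg by (meson add_nonneg_pos add_pos_nonneg)
  ultimately have 0: "Im \<xi> = 0" by simp
  then have "\<xi> = complex_of_real (Re \<xi>)" by (simp add: complex_eq_iff)
  moreover have "app g x = Re \<xi> * g x" "app h x = Re \<xi> * h x" if "x \<in> S" for x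
    using Re[OF that] Im[OF that] 0 by simp_all
  ultimately show ?thesis
    using \<open>g x \<noteq> 0 \<or> h x \<noteq> 0\<close> x(1) that[of "Re \<xi>" x g] that[of "Re \<xi>" x h] by metis
qed

lemma eigenvalueI:
  assumes "x \<in> S" "f x \<noteq> 0" "\<And>x. x \<in> S \<Longrightarrow> app f x = c * f x"
  shows "is_eigenvalue S P (complex_of_real c)"
  unfolding is_eigenvalue_def
proof (intro exI[of _ "\<lambda>x. complex_of_real (f x)"] conjI ballI bexI[of _ x])
  fix x assume "x \<in> S"
  from arg_cong[OF assms(3)[OF this], of complex_of_real]
  show "(\<Sum>y\<in>S. complex_of_real (P x y) * complex_of_real (f y)) = complex_of_real c * complex_of_real (f x)"
    by (simp add: kernel_apply_def)
qed (use assms in auto)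

lemma eigenfunction_orthogonal_const:
  assumes "\<And>x. x \<in> S \<Longrightarrow> app f x = c * f x" "c \<noteq> 1"
  shows "inner_w (\<lambda>_. 1) f = 0"
proof -
  have "inner_w (\<lambda>_. 1) f = inner_w (\<lambda>_. 1) (app f)" by (simp add: inner_app_const)
  also have "\<dots> = c * inner_w (\<lambda>_. 1) f"
    using assms(1) by (simp add: weighted_inner_def sum_distrib_left mult_ac)
  finally show ?thesis using assms(2) by simp
qed

text \<open>Functions that vanish against the constants and have norm \<open>1\<close> form, once extended by a default
  value outside \<open>S\<close>, a compact set in the product topology. It is nonempty when \<open>S\<close> has two
  elements.\<close>

lemma rayleigh_maximum_attained:
  assumes "x \<in> S" "y \<in> S" "x \<noteq> y"
  obtains g where "inner_w g g = 1" "inner_w (\<lambda>_. 1) g = 0"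
    "\<And>f. inner_w (\<lambda>_. 1) f = 0 \<Longrightarrow> inner_w f (app f) \<le> inner_w g (app g) * inner_w f f"
proof -
  define K where "K = {f. f \<in> extensional S \<and> inner_w f f = 1 \<and> inner_w (\<lambda>_. 1) f = 0}"
  define B where "B = (\<lambda>x. {- sqrt (1 / w x)..sqrt (1 / w x)})"
  have coord: "continuous_on UNIV (\<lambda>f::'s \<Rightarrow> real. f x)" for x
    by simp
  have cont_inner: "continuous_on UNIV (\<lambda>f. inner_w f f)"
    and cont_app: "continuous_on UNIV (\<lambda>f. inner_w f (app f))"
    and cont_const: "continuous_on UNIV (\<lambda>f. inner_w (\<lambda>_. 1) f)"
    unfolding weighted_inner_def kernel_apply_def by (intro continuous_intros coord)+
  have "K \<subseteq> PiE S B"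
  proof
    fix f assume f: "f \<in> K"
    have "f x \<in> B x" if "x \<in> S" for x
    proof -
      have nonneg: "0 \<le> w z * f z * f z" if "z \<in> S" for z
        using w_pos[OF that] by (simp add: mult.assoc)
      have "w x * f x * f x \<le> inner_w f f"
        unfolding weighted_inner_def
        by (rule member_le_sum[OF that nonneg finite_S]) simp
      then have "(f x)\<^sup>2 \<le> 1 / w x"
        using f w_pos[OF that] by (simp add: K_def field_simps power2_eq_square)
      then have "\<bar>f x\<bar> \<le> sqrt (1 / w x)" by (rule real_le_rsqrt[of "\<bar>f x\<bar>", simplified])
      then show ?thesis by (auto simp: B_def)
    qed
    then show "f \<in> PiE S B" using f by (auto simp: K_def PiE_def)
  qed
  moreover have "compact (PiE S B)"
  proof -
    have "PiE S B = (\<Pi>\<^sub>E i\<in>UNIV. if i \<in> S then B i else {undefined})"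
      by (auto simp: PiE_def extensional_def Pi_def split: if_splits)
    moreover have "compactin (product_topology (\<lambda>i::'s. euclidean :: real topology) UNIV)
        (\<Pi>\<^sub>E i\<in>UNIV. if i \<in> S then B i else {undefined})"
      unfolding compactin_PiE by (auto simp: B_def)
    ultimately show ?thesis by (simp add: euclidean_product_topology)
  qed
  moreover have "closed {f. inner_w f f = 1 \<and> inner_w (\<lambda>_. 1) f = 0}"
    by (intro closed_Collect_conj closed_Collect_eq cont_inner cont_const continuous_on_const)
  ultimately have "compact K"
  proof -
    have "K = PiE S B \<inter> {f. inner_w f f = 1 \<and> inner_w (\<lambda>_. 1) f = 0}"
      using \<open>K \<subseteq> PiE S B\<close> by (auto simp: K_def PiE_def)
    then show ?thesis
      using \<open>compact (PiE S B)\<close> \<open>closed _\<close> by (simp add: compact_Int_closed)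
  qed
  \<comment> \<open>Every nonzero function orthogonal to the constants has a normalised representative in \<open>K\<close>.\<close>
  have scaled: "\<exists>h\<in>K. \<forall>x\<in>S. f x = sqrt (inner_w f f) * h x"
    if "inner_w (\<lambda>_. 1) f = 0" "inner_w f f \<noteq> 0" for f
  proof -
    define h where "h = restrict (\<lambda>x. f x / sqrt (inner_w f f)) S"
    have pos: "0 < inner_w f f" using that(2) inner_self_nonneg[of f] by linarith
    have "inner_w h h = inner_w f f / (sqrt (inner_w f f) * sqrt (inner_w f f))"
      by (simp add: weighted_inner_def h_def sum_divide_distrib)
    moreover have "inner_w (\<lambda>_. 1) h = inner_w (\<lambda>_. 1) f / sqrt (inner_w f f)"
      by (simp add: weighted_inner_def h_def sum_divide_distrib)
    ultimately have "h \<in> K" using that pos by (simp add: K_def h_def)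
    moreover have "\<forall>x\<in>S. f x = sqrt (inner_w f f) * h x" using pos by (simp add: h_def)
    ultimately show ?thesis by blast
  qed
  have "K \<noteq> {}"
  proof -
    \<comment> \<open>A nonzero function orthogonal to the constants, supported on two points.\<close>
    define d where "d = (\<lambda>z. if z = x then 1 / w x else if z = y then - 1 / w y else 0)"
    have "inner_w (\<lambda>_. 1) d = (\<Sum>z\<in>{x, y}. w z * 1 * d z)"
      unfolding weighted_inner_def
      by (rule sum.mono_neutral_right) (use assms finite_S in \<open>auto simp: d_def\<close>)
    also have "\<dots> = 0" using assms w_pos[of x] w_pos[of y] by (simp add: d_def)
    finally have "inner_w (\<lambda>_. 1) d = 0" .
    moreover have "inner_w d d \<noteq> 0"
      using inner_self_pos[OF assms(1), of d] w_pos[OF assms(1)] by (simp add: d_def)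
    ultimately show ?thesis using scaled[of d] by blast
  qed
  have "\<exists>g\<in>K. \<forall>f\<in>K. inner_w f (app f) \<le> inner_w g (app g)"
    by (rule continuous_attains_sup[OF \<open>compact K\<close> \<open>K \<noteq> {}\<close> continuous_on_subset[OF cont_app]]) simp
  then obtain g where g: "g \<in> K" "\<And>f. f \<in> K \<Longrightarrow> inner_w f (app f) \<le> inner_w g (app g)"
    by blast
  have "inner_w f (app f) \<le> inner_w g (app g) * inner_w f f" if orth: "inner_w (\<lambda>_. 1) f = 0" for f
  proof (cases "inner_w f f = 0")
    case True
    then have "inner_w f (app f) = 0"
      using inner_self_eq_0[OF True] by (simp add: weighted_inner_def)
    with True show ?thesis by simp
  next
    case False
    then obtain h where h: "h \<in> K" "\<forall>x\<in>S. f x = sqrt (inner_w f f) * h x"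
      using scaled[OF orth] by blast
    have "inner_w f (app f) = (sqrt (inner_w f f) * sqrt (inner_w f f)) * inner_w h (app h)"
      unfolding weighted_inner_def[of S w f "app f"] weighted_inner_def[of S w h "app h"]
        kernel_apply_def sum_distrib_left
      by (intro sum.cong refl) (simp add: h(2)[rule_format] mult_ac)
    also have "\<dots> = inner_w f f * inner_w h (app h)"
      using inner_self_nonneg[of f] by simp
    also have "\<dots> \<le> inner_w f f * inner_w g (app g)"
      by (intro mult_left_mono g h inner_self_nonneg)
    finally show ?thesis by (simp add: mult.commute)
  qed
  moreover have "inner_w g g = 1" "inner_w (\<lambda>_. 1) g = 0" using g(1) by (simp_all add: K_def)
  ultimately show ?thesis using that by metis
qed

lemma rayleigh_maximum_eigenvalue:
  assumes "x \<in> S" "y \<in> S" "x \<noteq> y"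
  obtains c g z where "z \<in> S" "g z \<noteq> 0" "inner_w (\<lambda>_. 1) g = 0" "\<And>x. x \<in> S \<Longrightarrow> app g x = c * g x"
    "\<And>f. inner_w (\<lambda>_. 1) f = 0 \<Longrightarrow> inner_w f (app f) \<le> c * inner_w f f"
proof -
  obtain g where g: "inner_w g g = 1" "inner_w (\<lambda>_. 1) g = 0"
    and max: "\<And>f. inner_w (\<lambda>_. 1) f = 0 \<Longrightarrow> inner_w f (app f) \<le> inner_w g (app g) * inner_w f f"
    by (rule rayleigh_maximum_attained[OF assms]) (rule that; assumption)
  define c where "c = inner_w g (app g)"
  define h where "h = (\<lambda>x. c * g x + (- 1) * app g x)"
  have h0: "inner_w (\<lambda>_. 1) h = 0"
    unfolding h_def weighted_inner_linear by (simp add: g inner_app_const)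
  \<comment> \<open>The form \<open>c \<langle>f, f\<rangle> - \<langle>f, P f\<rangle>\<close> is nonnegative and vanishes at \<open>g\<close>, so its first
    variation at \<open>g\<close> in the direction \<open>h\<close>, which is \<open>2 \<langle>h, h\<rangle>\<close>, vanishes.\<close>
  define b where "b = c * inner_w h h - inner_w h (app h)"
  have nonneg: "0 \<le> 2 * t * inner_w h h + t * t * b" for t
  proof -
    define f where "f = (\<lambda>x. 1 * g x + t * h x)"
    have "inner_w (\<lambda>_. 1) f = 0"
      unfolding f_def weighted_inner_linear by (simp add: g h0)
    from max[OF this] have le: "inner_w f (app f) \<le> c * inner_w f f" by (simp add: c_def)
    have ff: "inner_w f f = 1 + 2 * t * inner_w h g + t * t * inner_w h h"
      unfolding f_def weighted_inner_linear weighted_inner_commute[of S w g h]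
      by (simp add: g algebra_simps)
    have fPf: "inner_w f (app f) = c + 2 * t * inner_w h (app g) + t * t * inner_w h (app h)"
    proof -
      have "inner_w f (app f) = inner_w f (\<lambda>x. 1 * app g x + t * app h x)"
        unfolding f_def kernel_apply_linear ..
      also have "\<dots> = inner_w g (app g) + t * inner_w g (app h) + t * inner_w h (app g)
          + t * t * inner_w h (app h)"
        unfolding weighted_inner_linear f_def by (simp add: algebra_simps)
      also have "inner_w g (app h) = inner_w h (app g)"
        by (metis app_symmetric weighted_inner_commute)
      finally show ?thesis by (simp add: c_def algebra_simps)
    qed
    have hPg: "inner_w h (app g) = c * inner_w h g - inner_w h h"
    proof -
      have "inner_w h h = inner_w h (\<lambda>x. c * g x + (- 1) * app g x)" by (simp add: h_def)
      then show ?thesis unfolding weighted_inner_linear by simp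
    qed
    from le have "c + 2 * t * (c * inner_w h g - inner_w h h) + t * t * inner_w h (app h)
        \<le> c * (1 + 2 * t * inner_w h g + t * t * inner_w h h)"
      unfolding fPf ff hPg .
    then show ?thesis by (simp add: b_def algebra_simps)
  qed
  have "inner_w h h = 0"
  proof (rule ccontr)
    assume "inner_w h h \<noteq> 0"
    then have pos: "0 < inner_w h h" using inner_self_nonneg[of h] by linarith
    define t where "t = inner_w h h / (\<bar>b\<bar> + 1)"
    \<comment> \<open>Small enough for the linear term to dominate the quadratic one.\<close>
    have t: "0 < t" using pos by (simp add: t_def divide_pos_pos add_pos_nonneg)
    have "t * \<bar>b\<bar> \<le> inner_w h h" using pos
      by (simp add: t_def field_simps add_pos_nonneg)
    moreover have "t * b \<le> t * \<bar>b\<bar>" using t by simp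
    ultimately have "- 2 * inner_w h h + t * b < 0" using pos by linarith
    then have "t * (- 2 * inner_w h h + t * b) < 0" using t by (simp add: mult_pos_neg)
    moreover have "0 \<le> t * (- 2 * inner_w h h + t * b)"
      using nonneg[of "- t"] by (simp add: algebra_simps)
    ultimately show False by linarith
  qed
  then have eig: "app g x = c * g x" if "x \<in> S" for x
    using inner_self_eq_0[of h x] that by (simp add: h_def)
  have "\<exists>z\<in>S. g z \<noteq> 0"
  proof (rule ccontr)
    assume "\<not> (\<exists>z\<in>S. g z \<noteq> 0)"
    then have "inner_w g g = 0" by (simp add: weighted_inner_def)
    with g(1) show False by simp
  qed
  then obtain z where "z \<in> S" "g z \<noteq> 0" by blast
  then show ?thesis using that[of z g c, OF _ _ g(2) eig max[folded c_def]] by blast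
qed

text \<open>The link between the gap and the quadratic form. Nonnegativity of the form makes the eigenvalues
  nonnegative, so the moduli in the definition of the gap may be dropped; the a priori bound with
  \<open>\<delta> > 0\<close> makes \<open>1\<close> an eigenvalue of constant functions only.\<close>

lemma spectral_gap_rayleigh:
  assumes "x \<in> S" "y \<in> S" "x \<noteq> y"
    and nonneg: "\<And>f. 0 \<le> inner_w f (app f)"
    and "0 < \<delta>"
    and \<delta>: "\<And>f. inner_w (\<lambda>_. 1) f = 0 \<Longrightarrow> inner_w f (app f) \<le> (1 - \<delta>) * inner_w f f"
  shows "\<delta> \<le> spectral_gap S P"
    and "inner_w (\<lambda>_. 1) f = 0 \<Longrightarrow> inner_w f (app f) \<le> (1 - spectral_gap S P) * inner_w f f"
proof -
  define M where "M = {cmod \<xi> |\<xi>. is_eigenvalue S P \<xi> \<and> \<xi> \<noteq> 1}"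
  have gap: "spectral_gap S P = 1 - Max M" by (simp add: spectral_gap_def M_def)
  have "M \<subseteq> cmod ` {\<xi>. is_eigenvalue S P \<xi>}" by (auto simp: M_def)
  then have finite: "finite M" using finite_eigenvalues[OF finite_S] finite_subset by blast
  obtain c g z where g: "z \<in> S" "g z \<noteq> 0" "inner_w (\<lambda>_. 1) g = 0" "\<And>x. x \<in> S \<Longrightarrow> app g x = c * g x"
    and max: "\<And>f. inner_w (\<lambda>_. 1) f = 0 \<Longrightarrow> inner_w f (app f) \<le> c * inner_w f f"
    by (rule rayleigh_maximum_eigenvalue[OF assms(1-3)]) (rule that; assumption)
  have bounds: "0 \<le> c" "c \<le> 1 - \<delta> \<or> c = 1"
    if "z \<in> S" "g z \<noteq> 0" "\<And>x. x \<in> S \<Longrightarrow> app g x = c * g x" for c g z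
  proof -
    have eq: "inner_w g (app g) = c * inner_w g g"
      using that(3) by (simp add: weighted_inner_def sum_distrib_left mult_ac)
    have pos: "0 < inner_w g g" using inner_self_pos that by blast
    show "0 \<le> c" using nonneg[of g] pos eq by (simp add: zero_le_mult_iff)
    show "c \<le> 1 - \<delta> \<or> c = 1"
    proof (cases "c = 1")
      case False
      then have "inner_w (\<lambda>_. 1) g = 0" using eigenfunction_orthogonal_const that(3) by blast
      from \<delta>[OF this] show ?thesis using eq pos by simp
    qed simp
  qed
  have "c \<noteq> 1"
  proof
    assume "c = 1"
    then have "inner_w g (app g) = inner_w g g"
      using g(4) by (simp add: weighted_inner_def)
    moreover have "0 < inner_w g g" using inner_self_pos g(1,2) by blast
    ultimately show False using \<delta>[OF g(3)] mult_pos_pos[OF \<open>0 < \<delta>\<close>]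
      by (fastforce simp: algebra_simps)
  qed
  then have "complex_of_real c \<noteq> 1" using of_real_eq_1_iff by blast
  then have cM: "cmod (complex_of_real c) \<in> M"
    using eigenvalueI[OF g(1,2,4)] unfolding M_def by blast
  then have "c \<le> Max M" using Max_ge[OF finite cM] by simp
  then show "inner_w f (app f) \<le> (1 - spectral_gap S P) * inner_w f f" if "inner_w (\<lambda>_. 1) f = 0"
    using max[OF that] mult_right_mono[OF _ inner_self_nonneg[of f], of c "Max M"] by (simp add: gap)
  have "Max M \<in> M" using finite cM Max_in by blast
  then obtain \<xi> where \<xi>: "is_eigenvalue S P \<xi>" "\<xi> \<noteq> 1" "Max M = cmod \<xi>" by (auto simp: M_def)
  obtain d f z where f: "\<xi> = complex_of_real d" "z \<in> S" "f z \<noteq> 0" "\<And>x. x \<in> S \<Longrightarrow> app f x = d * f x"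
    using real_eigenfunction[OF \<xi>(1)] by metis
  show "\<delta> \<le> spectral_gap S P" using bounds[OF f(2-4)] \<xi> f(1) by (auto simp: gap)
qed

end

section \<open>Sums over subsets\<close>

lemma weighted_cauchy_schwarz:
  fixes a f :: "'i \<Rightarrow> real"
  assumes "\<And>i. i \<in> I \<Longrightarrow> 0 \<le> a i"
  shows "(\<Sum>i\<in>I. a i * f i)\<^sup>2 \<le> (\<Sum>i\<in>I. a i) * (\<Sum>i\<in>I. a i * (f i)\<^sup>2)"
proof -
  have "(\<Sum>i\<in>I. sqrt (a i) * (sqrt (a i) * f i))\<^sup>2
      \<le> (\<Sum>i\<in>I. (sqrt (a i))\<^sup>2) * (\<Sum>i\<in>I. (sqrt (a i) * f i)\<^sup>2)"
    by (rule Cauchy_Schwarz_ineq_sum)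
  then show ?thesis using assms by (simp add: power_mult_distrib mult.assoc[symmetric])
qed

text \<open>Subsets of \<open>insert e M\<close> are paired according to whether they contain \<open>e\<close>.\<close>

lemma sum_Pow_insert:
  fixes g :: "'b set \<Rightarrow> real"
  assumes "finite M" "e \<notin> M"
  shows "(\<Sum>A\<in>Pow (insert e M). g A) = (\<Sum>A\<in>Pow M. g A + g (insert e A))"
proof -
  have "inj_on (insert e) (Pow M)" using assms(2) by (auto simp: inj_on_def)
  moreover have "Pow M \<inter> insert e ` Pow M = {}" using assms(2) by auto
  ultimately show ?thesis using assms(1)
    by (simp add: Pow_insert sum.union_disjoint sum.reindex sum.distrib)
qed

lemma sum_Pow_power_card:
  fixes r :: real
  assumes "finite M" shows "(\<Sum>A\<in>Pow M. r ^ card A) = (1 + r) ^ card M"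
  using assms
proof induction
  case (insert e M)
  have "(\<Sum>A\<in>Pow M. r ^ card A + r ^ card (insert e A)) = (\<Sum>A\<in>Pow M. (1 + r) * r ^ card A)"
  proof (intro sum.cong refl)
    fix A assume "A \<in> Pow M"
    then have "finite A" "e \<notin> A" using insert.hyps finite_subset by auto
    then show "r ^ card A + r ^ card (insert e A) = (1 + r) * r ^ card A"
      by (simp add: algebra_simps)
  qed
  then show ?case using insert by (simp add: sum_Pow_insert flip: sum_distrib_left)
qed simp

section \<open>Compatible colourings and edge updates\<close>

text \<open>The standing data: a finite graph and the parameters of the random-cluster model.\<close>

locale random_cluster =
  fixes V :: "'v set" and E :: "'v set set" and p :: real and q :: nat
  assumes graph: "finite_graph V E" and p_pos: "0 < p" and p_less_1: "p < 1" and q_pos: "1 \<le> q"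
begin

abbreviation colourings :: "'v set set \<Rightarrow> ('v \<Rightarrow> nat) set" where
  "colourings \<equiv> compatible_colourings V q"

text \<open>The unnormalised random-cluster weight. The power \<open>q ^ c(A)\<close> is encoded as the number of compatible
  colourings, which is the form in which it is used; the two agree by \<open>weight_eq\<close> below.\<close>

definition weight :: "'v set set \<Rightarrow> real" where
  "weight A = (p / (1 - p)) ^ card A * real (card (colourings A))"

lemma finite_V: "finite V" and edge_subset: "e \<in> E \<Longrightarrow> e \<subseteq> V"
  using graph by (auto simp: finite_graph_def)

lemma edgeE:
  assumes "e \<in> E" obtains u v where "e = {u, v}" "u \<noteq> v" "u \<in> V" "v \<in> V"
  using assms graph by (auto simp: finite_graph_def card_2_iff)

lemma finite_E: "finite E"
proof (rule finite_subset)
  show "E \<subseteq> Pow V" using edge_subset by blast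
qed (simp add: finite_V)

lemma finite_config: "A \<subseteq> E \<Longrightarrow> finite A"
  using finite_E finite_subset by blast

lemma finite_potts: "finite (potts_states V q)"
  by (simp add: potts_states_def finite_PiE finite_V)

lemma finite_colourings: "finite (colourings A)"
  using finite_potts by (simp add: compatible_colourings_def)

lemma colouringsD: "\<sigma> \<in> colourings A \<Longrightarrow> {u, v} \<in> A \<Longrightarrow> \<sigma> u = \<sigma> v"
  by (auto simp: compatible_colourings_def)

lemma colourings_card_pos:
  assumes "A \<subseteq> E" shows "0 < card (colourings A)"
proof -
  have "u \<in> V" "v \<in> V" if "{u, v} \<in> A" for u v
    using that assms edge_subset by blast+
  then have "(\<lambda>v\<in>V. 1) \<in> colourings A"
    using q_pos by (auto simp: compatible_colourings_def potts_states_def)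
  then show ?thesis using finite_colourings card_gt_0_iff by blast
qed

lemma odds_pos: "0 < p / (1 - p)"
  using p_pos p_less_1 by simp

lemma weight_pos: "A \<subseteq> E \<Longrightarrow> 0 < weight A"
  using colourings_card_pos odds_pos by (simp add: weight_def)

lemma finite_mono_edges: "finite (mono_edges E \<sigma>)" and mono_edges_subset: "mono_edges E \<sigma> \<subseteq> E"
  using finite_E by (auto simp: mono_edges_def intro: finite_subset[of _ E])

lemma colourings_iff_mono_edges:
  assumes "A \<subseteq> E" "\<sigma> \<in> potts_states V q"
  shows "\<sigma> \<in> colourings A \<longleftrightarrow> A \<subseteq> mono_edges E \<sigma>"
proof
  assume \<sigma>: "\<sigma> \<in> colourings A"
  show "A \<subseteq> mono_edges E \<sigma>"
  proof
    fix e assume "e \<in> A"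
    moreover from this obtain u v where "e = {u, v}" using assms(1) edgeE by blast
    ultimately have "e = {u, v} \<and> {u, v} \<in> E \<and> \<sigma> u = \<sigma> v"
      using colouringsD[OF \<sigma>, of u v] assms(1) by blast
    then show "e \<in> mono_edges E \<sigma>" unfolding mono_edges_def by blast
  qed
next
  assume "A \<subseteq> mono_edges E \<sigma>"
  then have "\<sigma> u = \<sigma> v" if "{u, v} \<in> A" for u v
    using that by (force simp: mono_edges_def doubleton_eq_iff)
  then show "\<sigma> \<in> colourings A" using assms(2) by (simp add: compatible_colourings_def)
qed

lemma equiv_connection: "equiv V (connection V A)"
proof (rule equivI)
  show "sym (connection V A)"
    unfolding connection_def by (intro sym_Int sym_rtrancl) (auto simp: sym_def insert_commute)
  show "trans (connection V A)"
    unfolding connection_def by (rule trans_Int) (auto simp: trans_rtrancl trans_def)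
qed (auto simp: connection_def refl_on_def)

lemma connection_colour:
  assumes "\<sigma> \<in> colourings A" "(u, v) \<in> connection V A" shows "\<sigma> u = \<sigma> v"
proof -
  have "(u, v) \<in> {(u, v). {u, v} \<in> A}\<^sup>*" using assms(2) by (simp add: connection_def)
  then show ?thesis
    by (induction rule: rtrancl_induct) (use colouringsD[OF assms(1)] in auto)
qed

lemma connection_edge:
  assumes "A \<subseteq> E" "{u, v} \<in> A" shows "(u, v) \<in> connection V A"
  using assms edge_subset[of "{u, v}"] by (auto simp: connection_def)

text \<open>A compatible colouring is a choice of one colour for each connected component.\<close>

lemma card_colourings:
  assumes "A \<subseteq> E" shows "card (colourings A) = q ^ num_components V A"
proof -
  let ?R = "connection V A"
  note eq = equiv_connection[of A]
  have class_in: "?R `` {v} \<in> V // ?R" if "v \<in> V" for v using that by (rule quotientI)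
  have image: "the_elem (\<sigma> ` (?R `` {v})) = \<sigma> v" if "\<sigma> \<in> colourings A" "v \<in> V" for \<sigma> v
  proof -
    have "\<sigma> ` (?R `` {v}) = {\<sigma> v}"
    proof
      show "\<sigma> ` (?R `` {v}) \<subseteq> {\<sigma> v}"
        using connection_colour[OF that(1), of v] by auto
      show "{\<sigma> v} \<subseteq> \<sigma> ` (?R `` {v})"
        using equiv_class_self[OF eq that(2)] by blast
    qed
    then show ?thesis by simp
  qed
  have "bij_betw (\<lambda>g. \<lambda>v\<in>V. g (?R `` {v})) (V // ?R \<rightarrow>\<^sub>E {1..q}) (colourings A)"
  proof (rule bij_betw_byWitness[where f' = "\<lambda>\<sigma>. \<lambda>C\<in>V // ?R. the_elem (\<sigma> ` C)"])
    show im: "(\<lambda>g. \<lambda>v\<in>V. g (?R `` {v})) ` (V // ?R \<rightarrow>\<^sub>E {1..q}) \<subseteq> colourings A"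
    proof (rule image_subsetI)
      fix g assume g: "g \<in> V // ?R \<rightarrow>\<^sub>E {1..q}"
      have "u \<in> V \<and> v \<in> V \<and> ?R `` {u} = ?R `` {v}" if "{u, v} \<in> A" for u v
        using equiv_class_eq[OF eq connection_edge[OF assms that]] connection_edge[OF assms that]
        by (auto simp: connection_def)
      then show "(\<lambda>v\<in>V. g (?R `` {v})) \<in> colourings A"
        using PiE_mem[OF g class_in] by (auto simp: compatible_colourings_def potts_states_def)
    qed
    show "\<forall>g\<in>V // ?R \<rightarrow>\<^sub>E {1..q}. (\<lambda>C\<in>V // ?R. the_elem ((\<lambda>v\<in>V. g (?R `` {v})) ` C)) = g"
    proof
      fix g assume g: "g \<in> V // ?R \<rightarrow>\<^sub>E {1..q}"
      then have col: "(\<lambda>v\<in>V. g (?R `` {v})) \<in> colourings A" using im by blast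
      show "(\<lambda>C\<in>V // ?R. the_elem ((\<lambda>v\<in>V. g (?R `` {v})) ` C)) = g"
      proof (rule extensionalityI[of _ "V // ?R"])
        fix C assume "C \<in> V // ?R"
        moreover from this obtain v where "v \<in> V" "C = ?R `` {v}" by (rule quotientE)
        ultimately show "(\<lambda>C\<in>V // ?R. the_elem ((\<lambda>v\<in>V. g (?R `` {v})) ` C)) C = g C"
          using image[OF col] by simp
      qed (use g in \<open>auto simp: PiE_def\<close>)
    qed
    show "\<forall>\<sigma>\<in>colourings A. (\<lambda>v\<in>V. (\<lambda>C\<in>V // ?R. the_elem (\<sigma> ` C)) (?R `` {v})) = \<sigma>"
    proof
      fix \<sigma> assume \<sigma>: "\<sigma> \<in> colourings A"
      then have "\<sigma> \<in> extensional V"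
        by (auto simp: compatible_colourings_def potts_states_def PiE_def)
      then show "(\<lambda>v\<in>V. (\<lambda>C\<in>V // ?R. the_elem (\<sigma> ` C)) (?R `` {v})) = \<sigma>"
        by (intro extensionalityI[of _ V]) (auto simp: image[OF \<sigma>] class_in)
    qed
    show "(\<lambda>\<sigma>. \<lambda>C\<in>V // ?R. the_elem (\<sigma> ` C)) ` colourings A \<subseteq> V // ?R \<rightarrow>\<^sub>E {1..q}"
    proof (rule image_subsetI, rule restrict_PiE_iff[THEN iffD2], rule ballI)
      fix \<sigma> C assume \<sigma>: "\<sigma> \<in> colourings A" and "C \<in> V // ?R"
      then obtain v where "v \<in> V" "C = ?R `` {v}" by (auto elim: quotientE)
      then show "the_elem (\<sigma> ` C) \<in> {1..q}"
        using \<sigma> image[OF \<sigma>] by (auto simp: compatible_colourings_def potts_states_def PiE_def)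
    qed
  qed
  then have "card (colourings A) = card (V // ?R \<rightarrow>\<^sub>E {1..q})" by (simp add: bij_betw_same_card)
  also have "\<dots> = q ^ num_components V A"
  proof -
    have "?R \<subseteq> V \<times> V" by (auto simp: connection_def)
    then have "finite (V // ?R)" using finite_quotient finite_V by blast
    then show ?thesis by (simp add: card_PiE num_components_def)
  qed
  finally show ?thesis .
qed

lemma weight_eq:
  assumes "A \<subseteq> E" shows "weight A = (p / (1 - p)) ^ card A * real q ^ num_components V A"
  by (simp add: weight_def card_colourings[OF assms])

lemma endpoints_connected_iff:
  assumes "u \<in> V" "v \<in> V"
  shows "endpoints_connected V A {u, v} \<longleftrightarrow> (u, v) \<in> connection V A"
proof -
  have "(u, u) \<in> connection V A" "(v, v) \<in> connection V A"
    using assms by (auto simp: connection_def)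
  moreover have "(v, u) \<in> connection V A" if "(u, v) \<in> connection V A"
    using equiv_connection[of A] that by (meson equivE symE)
  ultimately show ?thesis by (auto simp: endpoints_connected_def)
qed

lemma endpoints_connected_member:
  assumes "A \<subseteq> E" "e \<in> A" shows "endpoints_connected V A e"
proof -
  obtain u v where "e = {u, v}" "u \<in> V" "v \<in> V" using assms edgeE by blast
  then show ?thesis using endpoints_connected_iff connection_edge assms by metis
qed

lemma colourings_insert_connected:
  assumes "A \<subseteq> E" "e \<in> E" "endpoints_connected V A e"
  shows "colourings (insert e A) = colourings A"
proof -
  have "\<sigma> u = \<sigma> v" if "\<sigma> \<in> colourings A" "{u, v} = e" for \<sigma> u v
    using connection_colour[OF that(1)] assms(3) that(2) by (auto simp: endpoints_connected_def)
  then show ?thesis by (auto simp: compatible_colourings_def)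
qed

text \<open>If \<open>e\<close> joins two components, recolouring one of them turns a colouring compatible with
  \<open>insert e A\<close> and an arbitrary colour into a colouring compatible with \<open>A\<close>, bijectively.\<close>

lemma card_colourings_insert_disconnected:
  assumes "A \<subseteq> E" "e \<in> E" "\<not> endpoints_connected V A e"
  shows "card (colourings A) = q * card (colourings (insert e A))"
proof -
  obtain u v where e: "e = {u, v}" "u \<in> V" "v \<in> V" using assms(2) edgeE by blast
  let ?R = "connection V A"
  have uv: "(u, v) \<notin> ?R" using assms(3) e endpoints_connected_iff by metis
  have uu: "(u, u) \<in> ?R" using e by (simp add: connection_def)
  \<comment> \<open>The component of \<open>u\<close> is closed under edges of \<open>A\<close>, so recolouring it keeps compatibility.\<close>
  have edge: "(u, x) \<in> ?R \<longleftrightarrow> (u, y) \<in> ?R" if "{x, y} \<in> A" for x y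
    using equiv_connection[of A] connection_edge[OF assms(1) that]
    by (meson equivE symE transE)
  have in_V: "x \<in> V" "y \<in> V" if "{x, y} \<in> insert e A" for x y
    using that assms(1,2) edge_subset by blast+
  have sub: "\<sigma> \<in> colourings A" if "\<sigma> \<in> colourings (insert e A)" for \<sigma>
    using that by (auto simp: compatible_colourings_def)
  have range: "\<sigma> x \<in> {1..q}" "\<sigma> \<in> extensional V" if "\<sigma> \<in> colourings B" "x \<in> V" for \<sigma> B x
    using that by (auto simp: compatible_colourings_def potts_states_def PiE_def)
  define F where "F = (\<lambda>(\<sigma>, k :: nat). \<lambda>x\<in>V. if (u, x) \<in> ?R then k else \<sigma> x)"
  define G where "G = (\<lambda>\<tau> :: 'v \<Rightarrow> nat. (\<lambda>x\<in>V. if (u, x) \<in> ?R then \<tau> v else \<tau> x, \<tau> u))"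
  have "bij_betw F (colourings (insert e A) \<times> {1..q}) (colourings A)"
  proof (rule bij_betw_byWitness[where f' = G])
    show "\<forall>s\<in>colourings (insert e A) \<times> {1..q}. G (F s) = s"
    proof safe
      fix \<sigma> k assume \<sigma>: "\<sigma> \<in> colourings (insert e A)"
      have "\<sigma> v = \<sigma> u" using colouringsD[OF \<sigma>, of u v] e by simp
      then have "\<sigma> v = \<sigma> x" if "(u, x) \<in> ?R" for x
        using connection_colour[OF sub[OF \<sigma>] that] by simp
      then have "fst (G (F (\<sigma>, k))) = \<sigma>"
        using range(2)[OF \<sigma> e(2)] uv e
        by (intro extensionalityI[of _ V]) (auto simp: F_def G_def)
      moreover have "snd (G (F (\<sigma>, k))) = k" using uu e by (simp add: F_def G_def)
      ultimately show "G (F (\<sigma>, k)) = (\<sigma>, k)" by (simp add: prod_eq_iff)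
    qed
    show "\<forall>\<tau>\<in>colourings A. F (G \<tau>) = \<tau>"
    proof
      fix \<tau> assume \<tau>: "\<tau> \<in> colourings A"
      show "F (G \<tau>) = \<tau>"
        using range(2)[OF \<tau> e(2)] connection_colour[OF \<tau>]
        by (intro extensionalityI[of _ V]) (auto simp: F_def G_def)
    qed
    show "F ` (colourings (insert e A) \<times> {1..q}) \<subseteq> colourings A"
    proof safe
      fix \<sigma> k assume \<sigma>: "\<sigma> \<in> colourings (insert e A)" and k: "k \<in> {1..q}"
      have "F (\<sigma>, k) \<in> potts_states V q"
        using range(1)[OF \<sigma>] k by (auto simp: F_def potts_states_def)
      moreover have "F (\<sigma>, k) x = F (\<sigma>, k) y" if "{x, y} \<in> A" for x y
        using in_V[of x y] edge[OF that] colouringsD[OF sub[OF \<sigma>] that] that by (simp add: F_def)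
      ultimately show "F (\<sigma>, k) \<in> colourings A" by (simp add: compatible_colourings_def)
    qed
    show "G ` colourings A \<subseteq> colourings (insert e A) \<times> {1..q}"
    proof (rule image_subsetI)
      fix \<tau> assume \<tau>: "\<tau> \<in> colourings A"
      have "fst (G \<tau>) \<in> potts_states V q"
        using range(1)[OF \<tau>] e by (auto simp: G_def potts_states_def)
      moreover have "fst (G \<tau>) x = fst (G \<tau>) y" if xy: "{x, y} \<in> insert e A" for x y
      proof (cases "{x, y} = e")
        case True
        then have "(x = u \<and> y = v) \<or> (x = v \<and> y = u)" by (simp add: e doubleton_eq_iff)
        then show ?thesis using e uv uu by (auto simp: G_def)
      next
        case False
        then have "{x, y} \<in> A" using xy by blast
        then show ?thesis using in_V[OF xy] edge colouringsD[OF \<tau>] by (simp add: G_def)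
      qed
      moreover have "snd (G \<tau>) \<in> {1..q}" using range(1)[OF \<tau> e(2)] by (simp add: G_def)
      ultimately show "G \<tau> \<in> colourings (insert e A) \<times> {1..q}"
        by (simp add: compatible_colourings_def mem_Times_iff)
    qed
  qed
  then have "card (colourings A) = card (colourings (insert e A) \<times> {1..q})"
    by (simp add: bij_betw_same_card)
  then show ?thesis by (simp add: card_cartesian_product)
qed

text \<open>The probability that an update of \<open>e\<close> from the configuration \<open>A\<close> leaves \<open>e\<close> open.\<close>

definition open_prob :: "'v set \<Rightarrow> 'v set set \<Rightarrow> real" where
  "open_prob e A = (if endpoints_connected V A e then p else p / real q)"

lemma edge_update_insert: "edge_update V p q e A (insert e A) = open_prob e A"
  by (auto simp: edge_update_def open_prob_def Let_def)

lemma edge_update_remove: "edge_update V p q e A (A - {e}) = 1 - open_prob e A"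
  by (auto simp: edge_update_def open_prob_def Let_def)

lemma edge_update_other: "B \<noteq> insert e A \<Longrightarrow> B \<noteq> A - {e} \<Longrightarrow> edge_update V p q e A B = 0"
  unfolding edge_update_def by (subst if_not_P) auto

lemma sum_edge_update:
  assumes "A \<subseteq> E" "e \<in> E"
  shows "(\<Sum>B\<in>Pow E. edge_update V p q e A B * f B) =
    open_prob e A * f (insert e A) + (1 - open_prob e A) * f (A - {e})"
proof -
  have "(\<Sum>B\<in>Pow E. edge_update V p q e A B * f B) =
      (\<Sum>B\<in>{insert e A, A - {e}}. edge_update V p q e A B * f B)"
    by (rule sum.mono_neutral_right) (use assms finite_E edge_update_other in auto)
  also have "insert e A \<noteq> A - {e}" by blast
  then have "(\<Sum>B\<in>{insert e A, A - {e}}. edge_update V p q e A B * f B) =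
      open_prob e A * f (insert e A) + (1 - open_prob e A) * f (A - {e})"
    by (simp add: edge_update_insert edge_update_remove)
  finally show ?thesis .
qed

text \<open>Given \<open>A\<close>, a uniform compatible colouring makes \<open>e\<close> monochromatic with probability
  \<open>open_prob e A / p\<close>.\<close>

lemma card_colourings_insert:
  assumes "A \<subseteq> E" "e \<in> E"
  shows "real (card (colourings A)) * open_prob e A = real (card (colourings (insert e A))) * p"
  using colourings_insert_connected[OF assms] card_colourings_insert_disconnected[OF assms] q_pos
  by (simp add: open_prob_def)

lemma weight_insert:
  assumes "A \<subseteq> E" "e \<in> E" "e \<notin> A"
  shows "weight A * open_prob e A = weight (insert e A) * (1 - p)"
proof -
  have "weight A * open_prob e A =
      (p / (1 - p)) ^ card A * (real (card (colourings A)) * open_prob e A)"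
    by (simp add: weight_def)
  also have "\<dots> = (p / (1 - p)) ^ card A * (real (card (colourings (insert e A))) * p)"
    using card_colourings_insert[OF assms(1,2)] by simp
  also have "\<dots> = weight (insert e A) * (1 - p)"
    using assms p_less_1 finite_config[OF assms(1)] by (simp add: weight_def)
  finally show ?thesis .
qed

lemma edge_update_balance_insert:
  assumes "A \<subseteq> E" "e \<in> E" "e \<notin> A"
  shows "weight A * edge_update V p q e A (insert e A) =
    weight (insert e A) * edge_update V p q e (insert e A) A"
proof -
  have "endpoints_connected V (insert e A) e"
    using endpoints_connected_member[of "insert e A" e] assms by simp
  then have "edge_update V p q e (insert e A) A = 1 - p"
    using edge_update_remove[of e "insert e A"] assms(3) by (simp add: open_prob_def)
  then show ?thesis using weight_insert[OF assms] by (simp add: edge_update_insert)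
qed

lemma edge_update_balance:
  assumes "A \<subseteq> E" "B \<subseteq> E" "e \<in> E"
  shows "weight A * edge_update V p q e A B = weight B * edge_update V p q e B A"
proof -
  consider "A = B" | "B = insert e A" "e \<notin> A" | "A = insert e B" "e \<notin> B"
    | "\<not> (A - B) \<union> (B - A) \<subseteq> {e}" by blast
  then show ?thesis
  proof cases
    case 4
    then have "\<not> (B - A) \<union> (A - B) \<subseteq> {e}" by blast
    with 4 show ?thesis unfolding edge_update_def by (simp only: if_False mult_zero_right)
  qed (use edge_update_balance_insert assms in auto)
qed

section \<open>Swendsen-Wang dominates the single-bond dynamics\<close>

abbreviation rc_inner :: "('v set set \<Rightarrow> real) \<Rightarrow> ('v set set \<Rightarrow> real) \<Rightarrow> real" where
  "rc_inner \<equiv> weighted_inner (rc_states E) weight"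

abbreviation rc_apply ::
  "('v set set \<Rightarrow> 'v set set \<Rightarrow> real) \<Rightarrow> ('v set set \<Rightarrow> real) \<Rightarrow> 'v set set \<Rightarrow> real" where
  "rc_apply \<equiv> kernel_apply (rc_states E)"

abbreviation SW :: "'v set set \<Rightarrow> 'v set set \<Rightarrow> real" where
  "SW \<equiv> swendsen_wang V E p q"

abbreviation SB :: "'v set set \<Rightarrow> 'v set set \<Rightarrow> real" where
  "SB \<equiv> single_bond V E p q"

abbreviation update :: "'v set \<Rightarrow> 'v set set \<Rightarrow> 'v set set \<Rightarrow> real" where
  "update \<equiv> edge_update V p q"

abbreviation odds :: real where
  "odds \<equiv> p / (1 - p)"

lemma finite_rc_states: "finite (rc_states E)"
  by (simp add: rc_states_def finite_E)

lemma open_prob_bounds: "p / real q \<le> open_prob e A" "open_prob e A \<le> p"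
proof -
  have "p / real q \<le> p / 1"
    using q_pos p_pos by (intro divide_left_mono) auto
  then show "p / real q \<le> open_prob e A" "open_prob e A \<le> p" by (auto simp: open_prob_def)
qed

lemma open_prob_unit: "0 \<le> open_prob e A" "open_prob e A \<le> 1"
proof -
  have "0 \<le> p / real q" using p_pos by simp
  then show "0 \<le> open_prob e A" "open_prob e A \<le> 1"
    using open_prob_bounds[of e A] p_less_1 by linarith+
qed

lemma update_nonneg: "0 \<le> update e A B"
  using open_prob_unit[of e A] edge_update_insert[of e A] edge_update_remove[of e A]
    edge_update_other[of B e A]
  by (cases "B = insert e A"; cases "B = A - {e}") auto

lemma update_kernel:
  assumes "e \<in> E" shows "reversible_kernel (rc_states E) weight (update e)"
proof
  show "finite (rc_states E)" by (rule finite_rc_states)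
  fix A assume A: "A \<in> rc_states E"
  show "0 < weight A" using A weight_pos by (simp add: rc_states_def)
  show "(\<Sum>B\<in>rc_states E. update e A B) = 1"
    using sum_edge_update[of A e "\<lambda>_. 1"] A assms by (simp add: rc_states_def)
  show "weight A * update e A B = weight B * update e B A" if "B \<in> rc_states E" for B
    using A that edge_update_balance assms by (simp add: rc_states_def)
qed

lemma apply_SB:
  assumes "A \<in> rc_states E"
  shows "rc_apply SB f A = 1 / 2 * f A + 1 / (2 * real (card E)) * (\<Sum>e\<in>E. rc_apply (update e) f A)"
proof -
  have "rc_apply SB f A = (\<Sum>B\<in>rc_states E. (if A = B then 1 / 2 * f B else 0)
      + 1 / (2 * real (card E)) * (\<Sum>e\<in>E. update e A B * f B))"
    unfolding kernel_apply_def single_bond_def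
    by (intro sum.cong refl) (simp add: sum_distrib_right distrib_right mult.assoc)
  also have "\<dots> = (\<Sum>B\<in>rc_states E. if A = B then 1 / 2 * f B else 0)
      + 1 / (2 * real (card E)) * (\<Sum>B\<in>rc_states E. \<Sum>e\<in>E. update e A B * f B)"
    by (simp only: sum.distrib sum_distrib_left)
  also have "(\<Sum>B\<in>rc_states E. if A = B then 1 / 2 * f B else 0) = 1 / 2 * f A"
    using assms finite_rc_states by simp
  also have "(\<Sum>B\<in>rc_states E. \<Sum>e\<in>E. update e A B * f B) = (\<Sum>e\<in>E. rc_apply (update e) f A)"
    unfolding kernel_apply_def by (rule sum.swap)
  finally show ?thesis .
qed

lemma inner_SB:
  "rc_inner f (rc_apply SB f) =
    1 / 2 * rc_inner f f + 1 / (2 * real (card E)) * (\<Sum>e\<in>E. rc_inner f (rc_apply (update e) f))"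
proof -
  have "rc_inner f (rc_apply SB f) = (\<Sum>A\<in>rc_states E. 1 / 2 * (weight A * f A * f A)
      + 1 / (2 * real (card E)) * (\<Sum>e\<in>E. weight A * f A * rc_apply (update e) f A))"
    unfolding weighted_inner_def
    by (intro sum.cong refl) (simp add: apply_SB sum_distrib_left algebra_simps)
  also have "\<dots> = 1 / 2 * rc_inner f f + 1 / (2 * real (card E)) *
      (\<Sum>A\<in>rc_states E. \<Sum>e\<in>E. weight A * f A * rc_apply (update e) f A)"
    by (simp only: sum.distrib sum_distrib_left weighted_inner_def)
  also have "(\<Sum>A\<in>rc_states E. \<Sum>e\<in>E. weight A * f A * rc_apply (update e) f A) =
      (\<Sum>e\<in>E. rc_inner f (rc_apply (update e) f))"
    unfolding weighted_inner_def by (rule sum.swap)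
  finally show ?thesis .
qed

lemma SB_kernel:
  assumes "E \<noteq> {}" shows "reversible_kernel (rc_states E) weight SB"
proof
  show "finite (rc_states E)" by (rule finite_rc_states)
  fix A assume A: "A \<in> rc_states E"
  show "0 < weight A" using A weight_pos by (simp add: rc_states_def)
  have m: "real (card E) \<noteq> 0" using assms finite_E by simp
  have "(\<Sum>B\<in>rc_states E. SB A B) = rc_apply SB (\<lambda>_. 1) A" by (simp add: kernel_apply_def)
  also have "\<dots> = 1 / 2 + 1 / (2 * real (card E)) * (\<Sum>e\<in>E. 1)"
  proof -
    have "rc_apply (update e) (\<lambda>_. 1) A = 1" if "e \<in> E" for e
      by (rule reversible_kernel.app_const[OF update_kernel[OF that] A])
    then show ?thesis unfolding apply_SB[OF A] by simp
  qed
  finally show "(\<Sum>B\<in>rc_states E. SB A B) = 1" using m by simp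
  show "weight A * SB A B = weight B * SB B A" if "B \<in> rc_states E" for B
  proof -
    have "weight A * (\<Sum>e\<in>E. update e A B) = weight B * (\<Sum>e\<in>E. update e B A)"
      unfolding sum_distrib_left
      by (intro sum.cong refl reversible_kernel.balance[OF update_kernel] A that)
    then show ?thesis by (auto simp: single_bond_def algebra_simps)
  qed
qed

lemma weight_SW:
  assumes "A \<subseteq> E"
  shows "weight A * SW A B = odds ^ card A * odds ^ card B *
    (\<Sum>\<sigma>\<in>potts_states V q. (1 - p) ^ card (mono_edges E \<sigma>) * of_bool (\<sigma> \<in> colourings (A \<union> B)))"
  using q_pos by (simp add: weight_eq[OF assms] swendsen_wang_def)

lemma sum_mono_configs:
  fixes g :: "'v set set \<Rightarrow> real"
  shows "(\<Sum>A\<in>rc_states E. of_bool (A \<subseteq> mono_edges E \<sigma>) * g A) = (\<Sum>A\<in>Pow (mono_edges E \<sigma>). g A)"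
  unfolding rc_states_def
  by (rule sum.mono_neutral_cong_right) (use mono_edges_subset[of \<sigma>] finite_E in auto)

text \<open>For a fixed colouring, compatibility with \<open>A \<union> B\<close> decouples into a condition on \<open>A\<close> and one on \<open>B\<close>.\<close>

lemma sum_compatible_configs:
  fixes g :: "'v set set \<Rightarrow> real"
  assumes "A \<in> rc_states E" "\<sigma> \<in> potts_states V q"
  shows "(\<Sum>B\<in>rc_states E. of_bool (\<sigma> \<in> colourings (A \<union> B)) * g B) =
    of_bool (A \<subseteq> mono_edges E \<sigma>) * (\<Sum>B\<in>Pow (mono_edges E \<sigma>). g B)"
  unfolding sum_mono_configs[symmetric] sum_distrib_left
  by (intro sum.cong refl) (use assms colourings_iff_mono_edges in \<open>auto simp: rc_states_def\<close>)

text \<open>Given \<open>\<sigma>\<close>, the configuration is independent percolation with parameter \<open>p\<close> on the monochromatic edges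
  \<open>M\<close>, where a set \<open>A\<close> has probability \<open>(1 - p) ^ |M| * (p / (1 - p)) ^ |A|\<close>.\<close>

lemma sum_percolation: "finite M \<Longrightarrow> (1 - p) ^ card M * (\<Sum>A\<in>Pow M. odds ^ card A) = 1"
proof -
  assume M: "finite M"
  have "1 + odds = 1 / (1 - p)" using p_less_1 by (simp add: field_simps)
  then show ?thesis using p_less_1 by (simp add: sum_Pow_power_card[OF M] power_one_over)
qed

lemma SW_kernel: "reversible_kernel (rc_states E) weight SW"
proof
  show "finite (rc_states E)" by (rule finite_rc_states)
  fix A assume A': "A \<in> rc_states E"
  then have A: "A \<subseteq> E" by (simp add: rc_states_def)
  show "0 < weight A" using A weight_pos by simp
  show "weight A * SW A B = weight B * SW B A" if "B \<in> rc_states E" for B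
    using weight_SW[OF A, of B] weight_SW[of B A] that
    by (simp add: rc_states_def Un_commute mult.commute)
  have "(\<Sum>B\<in>rc_states E. weight A * SW A B) = odds ^ card A * (\<Sum>\<sigma>\<in>potts_states V q.
      (1 - p) ^ card (mono_edges E \<sigma>) *
      (\<Sum>B\<in>rc_states E. of_bool (\<sigma> \<in> colourings (A \<union> B)) * odds ^ card B))"
    unfolding weight_SW[OF A] sum_distrib_left
    by (subst sum.swap) (simp add: mult_ac)
  also have "\<dots> = odds ^ card A * (\<Sum>\<sigma>\<in>potts_states V q. of_bool (\<sigma> \<in> colourings A))"
  proof -
    have "(1 - p) ^ card (mono_edges E \<sigma>) *
        (\<Sum>B\<in>rc_states E. of_bool (\<sigma> \<in> colourings (A \<union> B)) * odds ^ card B)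
        = of_bool (\<sigma> \<in> colourings A)" if "\<sigma> \<in> potts_states V q" for \<sigma>
      using sum_percolation[OF finite_mono_edges, of \<sigma>]
      unfolding sum_compatible_configs[OF A' that] colourings_iff_mono_edges[OF A that] by simp
    then show ?thesis by simp
  qed
  also have "(\<Sum>\<sigma>\<in>potts_states V q. of_bool (\<sigma> \<in> colourings A)) = real (card (colourings A))"
  proof -
    have "potts_states V q \<inter> colourings A = colourings A" by (auto simp: compatible_colourings_def)
    then show ?thesis using finite_potts by (simp add: sum_of_bool_eq)
  qed
  finally have "weight A * (\<Sum>B\<in>rc_states E. SW A B) = weight A"
    by (simp add: sum_distrib_left weight_def)
  then show "(\<Sum>B\<in>rc_states E. SW A B) = 1" using weight_pos[OF A] by simp
qed

text \<open>Up to a positive factor for each \<open>\<sigma>\<close>, the form of the Swendsen-Wang kernel sums the squared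
  conditional expectations of \<open>f\<close> given \<open>\<sigma>\<close>.\<close>

lemma inner_SW:
  "rc_inner f (rc_apply SW f) = (\<Sum>\<sigma>\<in>potts_states V q. (1 - p) ^ card (mono_edges E \<sigma>) *
    (\<Sum>A\<in>Pow (mono_edges E \<sigma>). odds ^ card A * f A)\<^sup>2)"
proof -
  have "rc_inner f (rc_apply SW f) = (\<Sum>A\<in>rc_states E. \<Sum>B\<in>rc_states E. (weight A * SW A B) * (f A * f B))"
    by (simp add: weighted_inner_def kernel_apply_def sum_distrib_left mult_ac)
  also have "\<dots> = (\<Sum>A\<in>rc_states E. \<Sum>B\<in>rc_states E. \<Sum>\<sigma>\<in>potts_states V q.
      (1 - p) ^ card (mono_edges E \<sigma>) * ((odds ^ card A * f A) *
        (of_bool (\<sigma> \<in> colourings (A \<union> B)) * (odds ^ card B * f B))))"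
    by (intro sum.cong refl)
      (simp add: weight_SW rc_states_def sum_distrib_left sum_distrib_right mult_ac)
  also have "\<dots> = (\<Sum>A\<in>rc_states E. \<Sum>\<sigma>\<in>potts_states V q.
      (1 - p) ^ card (mono_edges E \<sigma>) * ((odds ^ card A * f A) *
      (\<Sum>B\<in>rc_states E. of_bool (\<sigma> \<in> colourings (A \<union> B)) * (odds ^ card B * f B))))"
    unfolding sum_distrib_left by (intro sum.cong refl sum.swap)
  also have "\<dots> = (\<Sum>A\<in>rc_states E. \<Sum>\<sigma>\<in>potts_states V q.
      (1 - p) ^ card (mono_edges E \<sigma>) * ((odds ^ card A * f A) *
      (of_bool (A \<subseteq> mono_edges E \<sigma>) * (\<Sum>B\<in>Pow (mono_edges E \<sigma>). odds ^ card B * f B))))"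
    by (simp only: sum_compatible_configs cong: sum.cong)
  also have "\<dots> = (\<Sum>\<sigma>\<in>potts_states V q. (1 - p) ^ card (mono_edges E \<sigma>) *
      ((\<Sum>A\<in>rc_states E. of_bool (A \<subseteq> mono_edges E \<sigma>) * (odds ^ card A * f A)) *
      (\<Sum>B\<in>Pow (mono_edges E \<sigma>). odds ^ card B * f B)))"
    by (subst sum.swap) (simp add: sum_distrib_left sum_distrib_right mult_ac)
  also have "\<dots> = (\<Sum>\<sigma>\<in>potts_states V q. (1 - p) ^ card (mono_edges E \<sigma>) *
      (\<Sum>A\<in>Pow (mono_edges E \<sigma>). odds ^ card A * f A)\<^sup>2)"
    by (simp only: sum_mono_configs power2_eq_square)
  finally show ?thesis .
qed

text \<open>The edge update in the joint model: given the colouring, \<open>e\<close> is resampled with parameter \<open>p\<close> if it is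
  monochromatic, and nothing happens otherwise.\<close>

definition coloured_update :: "'v set \<Rightarrow> ('v \<Rightarrow> nat) \<Rightarrow> ('v set set \<Rightarrow> real) \<Rightarrow> 'v set set \<Rightarrow> real" where
  "coloured_update e \<sigma> f A =
    (if e \<in> mono_edges E \<sigma> then p * f (insert e A) + (1 - p) * f (A - {e}) else f A)"

text \<open>Averaging the joint update over the colourings compatible with \<open>A\<close> gives the edge update. When the
  endpoints are not connected in \<open>A\<close>, the edge is closed, so that \<open>A - {e} = A\<close>.\<close>

lemma sum_coloured_update:
  assumes "A \<subseteq> E" "e \<in> E"
  shows "(\<Sum>\<sigma>\<in>colourings A. coloured_update e \<sigma> f A) =
    real (card (colourings A)) * rc_apply (update e) f A"
proof -
  let ?N = "real (card (colourings A))" and ?N' = "real (card (colourings (insert e A)))"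
  have apply_eq: "rc_apply (update e) f A = open_prob e A * f (insert e A) + (1 - open_prob e A) * f (A - {e})"
    using sum_edge_update[OF assms] by (simp add: kernel_apply_def rc_states_def)
  have mono: "{\<sigma> \<in> colourings A. e \<in> mono_edges E \<sigma>} = colourings (insert e A)"
  proof -
    have "\<sigma> \<in> colourings A \<and> e \<in> mono_edges E \<sigma> \<longleftrightarrow> \<sigma> \<in> colourings (insert e A)" for \<sigma>
    proof (cases "\<sigma> \<in> potts_states V q")
      case True
      then show ?thesis using assms by (simp add: colourings_iff_mono_edges conj_commute)
    qed (simp add: compatible_colourings_def)
    then show ?thesis by blast
  qed
  have sub: "colourings (insert e A) \<subseteq> colourings A" using mono by blast
  have "(\<Sum>\<sigma>\<in>colourings A. coloured_update e \<sigma> f A) =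
      (\<Sum>\<sigma>\<in>colourings A - colourings (insert e A). coloured_update e \<sigma> f A) +
      (\<Sum>\<sigma>\<in>colourings (insert e A). coloured_update e \<sigma> f A)"
    by (rule sum.subset_diff[OF sub finite_colourings])
  also have "(\<Sum>\<sigma>\<in>colourings A - colourings (insert e A). coloured_update e \<sigma> f A) =
      (\<Sum>\<sigma>\<in>colourings A - colourings (insert e A). f A)"
    by (rule sum.cong[OF refl]) (use mono in \<open>auto simp: coloured_update_def\<close>)
  also have "(\<Sum>\<sigma>\<in>colourings (insert e A). coloured_update e \<sigma> f A) =
      (\<Sum>\<sigma>\<in>colourings (insert e A). p * f (insert e A) + (1 - p) * f (A - {e}))"
    by (rule sum.cong[OF refl]) (use mono in \<open>auto simp: coloured_update_def\<close>)
  also have "(\<Sum>\<sigma>\<in>colourings A - colourings (insert e A). f A) +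
      (\<Sum>\<sigma>\<in>colourings (insert e A). p * f (insert e A) + (1 - p) * f (A - {e}))
    = (?N - ?N') * f A + ?N' * (p * f (insert e A) + (1 - p) * f (A - {e}))"
    using card_Diff_subset[OF finite_colourings sub] card_mono[OF finite_colourings sub]
    by (simp add: of_nat_diff)
  also have "\<dots> = ?N * rc_apply (update e) f A"
  proof (cases "endpoints_connected V A e")
    case True
    then show ?thesis
      using colourings_insert_connected[OF assms] by (simp add: apply_eq open_prob_def)
  next
    case False
    then have "A - {e} = A" using endpoints_connected_member[OF assms(1)] by blast
    moreover have "?N * open_prob e A = ?N' * p" by (rule card_colourings_insert[OF assms])
    then have "?N * (open_prob e A * f (insert e A) + (1 - open_prob e A) * f A) =
        (?N' * p) * f (insert e A) + (?N - ?N' * p) * f A"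
      by (simp add: algebra_simps)
    ultimately show ?thesis by (simp add: apply_eq algebra_simps)
  qed
  finally show ?thesis .
qed

lemma inner_update:
  assumes "e \<in> E"
  shows "rc_inner f (rc_apply (update e) f) = (\<Sum>\<sigma>\<in>potts_states V q.
    \<Sum>A\<in>Pow (mono_edges E \<sigma>). odds ^ card A * f A * coloured_update e \<sigma> f A)"
proof -
  have "rc_inner f (rc_apply (update e) f) =
      (\<Sum>A\<in>rc_states E. odds ^ card A * f A * (\<Sum>\<sigma>\<in>colourings A. coloured_update e \<sigma> f A))"
    unfolding weighted_inner_def
    by (intro sum.cong refl) (simp add: sum_coloured_update assms rc_states_def weight_def)
  also have "\<dots> = (\<Sum>A\<in>rc_states E. \<Sum>\<sigma>\<in>potts_states V q.
      of_bool (A \<subseteq> mono_edges E \<sigma>) * (odds ^ card A * f A * coloured_update e \<sigma> f A))"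
    unfolding sum_distrib_left
  proof (rule sum.cong[OF refl], rule sum.mono_neutral_cong_left[OF finite_potts])
    fix A assume A: "A \<in> rc_states E"
    show "colourings A \<subseteq> potts_states V q" by (auto simp: compatible_colourings_def)
    then show "odds ^ card A * f A * coloured_update e \<sigma> f A =
        of_bool (A \<subseteq> mono_edges E \<sigma>) * (odds ^ card A * f A * coloured_update e \<sigma> f A)"
      if "\<sigma> \<in> colourings A" for \<sigma>
      using that A colourings_iff_mono_edges[of A \<sigma>] by (auto simp: rc_states_def)
    show "\<forall>\<sigma>\<in>potts_states V q - colourings A.
        of_bool (A \<subseteq> mono_edges E \<sigma>) * (odds ^ card A * f A * coloured_update e \<sigma> f A) = 0"
      using A colourings_iff_mono_edges[of A] by (auto simp: rc_states_def)
  qed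
  also have "\<dots> = (\<Sum>\<sigma>\<in>potts_states V q. \<Sum>A\<in>rc_states E.
      of_bool (A \<subseteq> mono_edges E \<sigma>) * (odds ^ card A * f A * coloured_update e \<sigma> f A))"
    by (rule sum.swap)
  also have "\<dots> = (\<Sum>\<sigma>\<in>potts_states V q.
      \<Sum>A\<in>Pow (mono_edges E \<sigma>). odds ^ card A * f A * coloured_update e \<sigma> f A)"
    by (simp only: sum_mono_configs)
  finally show ?thesis .
qed

text \<open>For each colouring this is the Cauchy-Schwarz inequality for percolation on the monochromatic edges
  other than \<open>e\<close>, applied to \<open>coloured_update e \<sigma> f\<close>.\<close>

lemma inner_SW_le_inner_update:
  assumes "e \<in> E"
  shows "rc_inner f (rc_apply SW f) \<le> rc_inner f (rc_apply (update e) f)"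
  unfolding inner_SW inner_update[OF assms]
proof (rule sum_mono)
  fix \<sigma> assume "\<sigma> \<in> potts_states V q"
  define M where "M = mono_edges E \<sigma>"
  have M: "finite M" by (simp add: M_def finite_mono_edges)
  have odds: "0 \<le> odds ^ n" for n using odds_pos by simp
  have "(1 - p) ^ card M * (\<Sum>A\<in>Pow M. odds ^ card A * f A)\<^sup>2
      \<le> (\<Sum>A\<in>Pow M. odds ^ card A * f A * coloured_update e \<sigma> f A)"
  proof (cases "e \<in> M")
    case False
    have "(1 - p) ^ card M * (\<Sum>A\<in>Pow M. odds ^ card A * f A)\<^sup>2
        \<le> (1 - p) ^ card M * ((\<Sum>A\<in>Pow M. odds ^ card A) * (\<Sum>A\<in>Pow M. odds ^ card A * (f A)\<^sup>2))"
      using p_less_1 odds by (intro mult_left_mono weighted_cauchy_schwarz) auto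
    also have "\<dots> = (\<Sum>A\<in>Pow M. odds ^ card A * (f A)\<^sup>2)"
      using sum_percolation[OF M] by (simp add: mult.assoc[symmetric])
    also have "\<dots> = (\<Sum>A\<in>Pow M. odds ^ card A * f A * coloured_update e \<sigma> f A)"
      using False by (simp add: coloured_update_def M_def power2_eq_square mult.assoc)
    finally show ?thesis .
  next
    case True
    define M' where "M' = M - {e}"
    define g where "g = (\<lambda>A. p * f (insert e A) + (1 - p) * f A)"
    have M': "finite M'" "e \<notin> M'" "M = insert e M'" using M True by (auto simp: M'_def)
    have pair: "f A + odds * f (insert e A) = g A / (1 - p)" for A
      using p_less_1 by (simp add: g_def field_simps)
    have A: "card (insert e A) = Suc (card A)" "A - {e} = A" if "A \<in> Pow M'" for A
    proof -
      have "finite A" "e \<notin> A" using that M' finite_subset[of A M'] by auto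
      then show "card (insert e A) = Suc (card A)" "A - {e} = A" by auto
    qed
    have "(\<Sum>A\<in>Pow M. odds ^ card A * f A) = (\<Sum>A\<in>Pow M'. odds ^ card A * (f A + odds * f (insert e A)))"
      unfolding M'(3) sum_Pow_insert[OF M'(1,2)]
      by (intro sum.cong refl) (simp add: A algebra_simps)
    then have lhs: "(\<Sum>A\<in>Pow M. odds ^ card A * f A) = (\<Sum>A\<in>Pow M'. odds ^ card A * g A) / (1 - p)"
      unfolding pair by (simp add: sum_divide_distrib)
    have "coloured_update e \<sigma> f A = g A" "coloured_update e \<sigma> f (insert e A) = g A"
      if "A \<in> Pow M'" for A
      using True A[OF that] that M'(2) by (auto simp: coloured_update_def g_def M_def)
    then have "(\<Sum>A\<in>Pow M. odds ^ card A * f A * coloured_update e \<sigma> f A) =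
        (\<Sum>A\<in>Pow M'. odds ^ card A * (f A + odds * f (insert e A)) * g A)"
      unfolding M'(3) sum_Pow_insert[OF M'(1,2)]
      by (intro sum.cong refl) (simp add: A algebra_simps)
    then have rhs: "(\<Sum>A\<in>Pow M. odds ^ card A * f A * coloured_update e \<sigma> f A) =
        (\<Sum>A\<in>Pow M'. odds ^ card A * (g A)\<^sup>2) / (1 - p)"
      unfolding pair by (simp add: sum_divide_distrib power2_eq_square mult.assoc)
    have "(1 - p) ^ card M * (\<Sum>A\<in>Pow M. odds ^ card A * f A)\<^sup>2 =
        (1 - p) ^ card M' * (\<Sum>A\<in>Pow M'. odds ^ card A * g A)\<^sup>2 / (1 - p)"
    proof -
      have "a * b * (x / a)\<^sup>2 = b * x\<^sup>2 / a" if "a \<noteq> 0" for a b x :: real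
        using that by (simp add: power2_eq_square)
      from this[of "1 - p"] show ?thesis unfolding lhs using p_less_1 M' by simp
    qed
    also have "\<dots> \<le> (1 - p) ^ card M' *
        ((\<Sum>A\<in>Pow M'. odds ^ card A) * (\<Sum>A\<in>Pow M'. odds ^ card A * (g A)\<^sup>2)) / (1 - p)"
      using p_less_1 odds by (intro divide_right_mono mult_left_mono weighted_cauchy_schwarz) auto
    also have "\<dots> = (\<Sum>A\<in>Pow M'. odds ^ card A * (g A)\<^sup>2) / (1 - p)"
      using sum_percolation[OF M'(1)] by (simp add: mult.assoc[symmetric])
    finally show ?thesis by (simp add: rhs)
  qed
  then show "(1 - p) ^ card (mono_edges E \<sigma>) * (\<Sum>A\<in>Pow (mono_edges E \<sigma>). odds ^ card A * f A)\<^sup>2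
      \<le> (\<Sum>A\<in>Pow (mono_edges E \<sigma>). odds ^ card A * f A * coloured_update e \<sigma> f A)"
    by (simp add: M_def)
qed

lemma inner_SW_nonneg: "0 \<le> rc_inner f (rc_apply SW f)"
  unfolding inner_SW using p_less_1 by (intro sum_nonneg mult_nonneg_nonneg) auto

lemma inner_SW_le_inner_SB:
  assumes "E \<noteq> {}"
  shows "rc_inner f (rc_apply SW f) \<le> rc_inner f (rc_apply SB f)"
proof -
  have m: "0 < real (card E)" using assms finite_E by (simp add: card_gt_0_iff)
  obtain e where e: "e \<in> E" using assms by blast
  have "real (card E) * rc_inner f (rc_apply SW f) \<le> (\<Sum>e\<in>E. rc_inner f (rc_apply (update e) f))"
    using sum_mono[of E "\<lambda>_. rc_inner f (rc_apply SW f)"] inner_SW_le_inner_update by simp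
  moreover have "rc_inner f (rc_apply SW f) \<le> rc_inner f f"
    by (rule order_trans[OF inner_SW_le_inner_update[OF e]
          reversible_kernel.inner_app_le[OF update_kernel[OF e] update_nonneg]])
  then have "real (card E) * rc_inner f (rc_apply SW f) \<le> real (card E) * rc_inner f f"
    using m by simp
  ultimately have "2 * real (card E) * rc_inner f (rc_apply SW f)
      \<le> real (card E) * rc_inner f f + (\<Sum>e\<in>E. rc_inner f (rc_apply (update e) f))"
    by linarith
  then show ?thesis using m by (simp add: inner_SB field_simps)
qed

end

section \<open>Exchanging the configurations on a set of edges\<close>

text \<open>The difference of two colours modulo \<open>q\<close>, represented in \<open>{1..q}\<close>.\<close>

definition colour_diff :: "nat \<Rightarrow> nat \<Rightarrow> nat \<Rightarrow> nat" where
  "colour_diff q c d = nat ((int c - int d) mod int q) + 1"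

lemma colour_diff_range: "1 \<le> q \<Longrightarrow> colour_diff q c d \<in> {1..q}"
  by (simp add: colour_diff_def Suc_le_eq nat_less_iff)

lemma colour_diff_eq_iff:
  assumes "1 \<le> q"
  shows "colour_diff q c d = colour_diff q c' d' \<longleftrightarrow>
    (int c - int d) mod int q = (int c' - int d') mod int q"
  using assms by (simp add: colour_diff_def eq_nat_nat_iff)

lemma colour_diff_exchange:
  assumes "1 \<le> q" "colour_diff q c d = colour_diff q c' d'"
  shows "colour_diff q c c' = colour_diff q d d'"
proof -
  have "(int c - int d) mod int q = (int c' - int d') mod int q"
    using assms colour_diff_eq_iff by blast
  then have "int q dvd (int c - int d) - (int c' - int d')" by (simp add: mod_eq_dvd_iff)
  also have "(int c - int d) - (int c' - int d') = (int c - int c') - (int d - int d')" by simp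
  finally have "(int c - int c') mod int q = (int d - int d') mod int q" by (simp add: mod_eq_dvd_iff)
  then show ?thesis using assms(1) colour_diff_eq_iff by blast
qed

lemma colour_diff_cancel:
  assumes "colour_diff q c d = colour_diff q c' d" "c \<in> {1..q}" "c' \<in> {1..q}"
  shows "c = c'"
proof -
  have "1 \<le> q" using assms(2) by simp
  then have "(int c - int d) mod int q = (int c' - int d) mod int q"
    using assms(1) colour_diff_eq_iff by blast
  then have dvd: "int q dvd int c - int c'" by (simp add: mod_eq_dvd_iff)
  show ?thesis
  proof (rule ccontr)
    assume "c \<noteq> c'"
    then have "\<bar>int q\<bar> \<le> \<bar>int c - int c'\<bar>" using dvd by (intro dvd_imp_le_int) auto
    then show False using assms(2,3) by auto
  qed
qed

lemma card_le_fibre_bound: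
  assumes "finite A" "finite T" "h ` A \<subseteq> T"
    and "\<And>a. a \<in> A \<Longrightarrow> card {x \<in> A. h x = h a} \<le> n"
  shows "card A \<le> card T * n"
proof -
  have "card A = (\<Sum>t\<in>h ` A. card {x \<in> A. h x = t})"
    using sum.image_gen[OF assms(1), of "\<lambda>_. 1 :: nat" h] by simp
  also have "\<dots> \<le> (\<Sum>t\<in>h ` A. n)" by (intro sum_mono) (use assms(4) in auto)
  also have "\<dots> \<le> card T * n" using card_mono[OF assms(2,3)] by simp
  finally show ?thesis .
qed

text \<open>The configuration that agrees with \<open>Y\<close> on \<open>F\<close> and with \<open>X\<close> off \<open>F\<close>; thus \<open>swap_on F Y X\<close> is the
  complementary configuration.\<close>

definition swap_on :: "'e set \<Rightarrow> 'e set \<Rightarrow> 'e set \<Rightarrow> 'e set" where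
  "swap_on F X Y = (Y \<inter> F) \<union> (X - F)"

lemma swap_on_subset: "X \<subseteq> E \<Longrightarrow> Y \<subseteq> E \<Longrightarrow> swap_on F X Y \<subseteq> E"
  by (auto simp: swap_on_def)

lemma swap_on_involution: "swap_on F (swap_on F X Y) (swap_on F Y X) = X"
  by (auto simp: swap_on_def)

lemma card_swap_on:
  assumes "finite X" "finite Y"
  shows "card (swap_on F X Y) + card (swap_on F Y X) = card X + card Y"
proof -
  have "card (swap_on F A B) = card (B \<inter> F) + card (A - F)" if "finite A" "finite B" for A B
    unfolding swap_on_def using that by (intro card_Un_disjoint) auto
  then show ?thesis
    using card_Int_Diff[OF assms(1), of F] card_Int_Diff[OF assms(2), of F] assms by simp
qed

context random_cluster
begin

text \<open>The vertices incident both to an edge in \<open>F\<close> and to an edge outside \<open>F\<close>.\<close>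

definition boundary :: "'v set set \<Rightarrow> 'v set" where
  "boundary F = {v\<in>V. (\<exists>e\<in>F. v \<in> e) \<and> (\<exists>e\<in>E - F. v \<in> e)}"

text \<open>Two colourings that agree on the boundary of \<open>F\<close> may be glued along it, with \<open>b\<close> on the vertices that
  touch \<open>F\<close> and \<open>a\<close> on the others.\<close>

lemma glued_colouring:
  assumes "X \<subseteq> E" "Y \<subseteq> E" "F \<subseteq> E"
    and a: "\<And>x y. {x, y} \<in> X \<Longrightarrow> a x = a y" and b: "\<And>x y. {x, y} \<in> Y \<Longrightarrow> b x = b y"
    and ab: "\<And>v. v \<in> boundary F \<Longrightarrow> a v = b v"
    and range: "\<And>v. v \<in> V \<Longrightarrow> a v \<in> {1..q}" "\<And>v. v \<in> V \<Longrightarrow> b v \<in> {1..q}"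
  shows "(\<lambda>v\<in>V. if v \<in> \<Union>F then b v else a v) \<in> colourings (swap_on F X Y)"
proof -
  let ?c = "\<lambda>v\<in>V. if v \<in> \<Union>F then b v else a v"
  have "?c \<in> potts_states V q" using range by (auto simp: potts_states_def)
  moreover have "?c x = ?c y" if "{x, y} \<in> swap_on F X Y" for x y
  proof (cases "{x, y} \<in> Y \<inter> F")
    case True
    then have "x \<in> V" "y \<in> V" "x \<in> \<Union>F" "y \<in> \<Union>F" using assms(3) edge_subset[of "{x, y}"] by blast+
    then show ?thesis using b True by simp
  next
    case False
    then have xy: "{x, y} \<in> X" "{x, y} \<in> E - F" using that assms(1) by (auto simp: swap_on_def)
    then have V: "x \<in> V" "y \<in> V" using edge_subset[of "{x, y}"] by auto
    have "?c z = a z" if "z \<in> {x, y}" for z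
    proof (cases "z \<in> \<Union>F")
      case True
      then have "z \<in> boundary F" using xy that V unfolding boundary_def by blast
      then show ?thesis using ab V that by auto
    qed (use V that in auto)
    then show ?thesis using a[OF xy(1)] by simp
  qed
  ultimately show ?thesis by (simp add: compatible_colourings_def)
qed

text \<open>The exponent is the size of the boundary and not twice this size, because only one difference per
  boundary vertex is recorded: within a class, the increments of \<open>\<sigma>\<close> and of \<open>\<tau>\<close> relative to a reference
  pair agree on the boundary, and so both exchanged pairs can be glued.\<close>

lemma card_colourings_swap:
  assumes "X \<subseteq> E" "Y \<subseteq> E" "F \<subseteq> E"
  shows "card (colourings X) * card (colourings Y) \<le>
    q ^ card (boundary F) * (card (colourings (swap_on F X Y)) * card (colourings (swap_on F Y X)))"
proof -
  let ?A = "colourings X \<times> colourings Y"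
  let ?B = "colourings (swap_on F X Y) \<times> colourings (swap_on F Y X)"
  \<comment> \<open>The classes of pairs are the fibres of \<open>h\<close>, and there are at most \<open>q ^ card (boundary F)\<close> of them.\<close>
  define h where "h = (\<lambda>(\<sigma>, \<tau>). \<lambda>v\<in>boundary F. colour_diff q (\<sigma> v) (\<tau> v))"
  have boundary_V: "boundary F \<subseteq> V" by (auto simp: boundary_def)
  then have finite_boundary: "finite (boundary F)" using finite_V finite_subset by blast
  have range: "\<sigma> v \<in> {1..q}" "\<sigma> \<in> extensional V" if "\<sigma> \<in> colourings B" "v \<in> V" for \<sigma> B v
    using that by (auto simp: compatible_colourings_def potts_states_def PiE_def)
  have fibre: "card {s \<in> ?A. h s = h s0} \<le> card ?B" if s0: "s0 \<in> ?A" for s0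
  proof -
    obtain \<sigma>0 \<tau>0 where s0_eq: "s0 = (\<sigma>0, \<tau>0)" by fastforce
    \<comment> \<open>Increments relative to the reference pair are taken first, and then exchanged on the vertices of \<open>F\<close>.\<close>
    define g where "g = (\<lambda>(\<sigma>, \<tau>).
      (\<lambda>v\<in>V. if v \<in> \<Union>F then colour_diff q (\<tau> v) (\<tau>0 v) else colour_diff q (\<sigma> v) (\<sigma>0 v),
       \<lambda>v\<in>V. if v \<in> \<Union>F then colour_diff q (\<sigma> v) (\<sigma>0 v) else colour_diff q (\<tau> v) (\<tau>0 v)))"
    have "g ` {s \<in> ?A. h s = h s0} \<subseteq> ?B"
    proof (rule image_subsetI)
      fix s assume s: "s \<in> {s \<in> ?A. h s = h s0}"
      obtain \<sigma> \<tau> where s_eq: "s = (\<sigma>, \<tau>)" by fastforce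
      have col: "\<sigma> \<in> colourings X" "\<tau> \<in> colourings Y" "\<sigma>0 \<in> colourings X" "\<tau>0 \<in> colourings Y"
        using s s0 by (auto simp: s_eq s0_eq)
      have eq: "colour_diff q (\<sigma> v) (\<sigma>0 v) = colour_diff q (\<tau> v) (\<tau>0 v)" if "v \<in> boundary F" for v
      proof (rule colour_diff_exchange[OF q_pos])
        have "h s v = h s0 v" using s by simp
        then show "colour_diff q (\<sigma> v) (\<tau> v) = colour_diff q (\<sigma>0 v) (\<tau>0 v)"
          using that by (simp add: h_def s_eq s0_eq)
      qed
      have X: "colour_diff q (\<sigma> x) (\<sigma>0 x) = colour_diff q (\<sigma> y) (\<sigma>0 y)" if "{x, y} \<in> X" for x y
        using colouringsD[OF col(1) that] colouringsD[OF col(3) that] by simp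
      have Y: "colour_diff q (\<tau> x) (\<tau>0 x) = colour_diff q (\<tau> y) (\<tau>0 y)" if "{x, y} \<in> Y" for x y
        using colouringsD[OF col(2) that] colouringsD[OF col(4) that] by simp
      have "fst (g s) \<in> colourings (swap_on F X Y)"
        unfolding g_def s_eq fst_conv prod.case
        by (rule glued_colouring[OF assms]) (use X Y eq colour_diff_range[OF q_pos] in blast)+
      moreover have "snd (g s) \<in> colourings (swap_on F Y X)"
        unfolding g_def s_eq snd_conv prod.case
        by (rule glued_colouring[OF assms(2,1,3)])
          (use X Y eq[symmetric] colour_diff_range[OF q_pos] in blast)+
      ultimately show "g s \<in> ?B" by (simp add: mem_Times_iff)
    qed
    moreover have "inj_on g {s \<in> ?A. h s = h s0}"
    proof (rule inj_onI)
      fix s t assume s: "s \<in> {s \<in> ?A. h s = h s0}" and t: "t \<in> {s \<in> ?A. h s = h s0}" and eq: "g s = g t"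
      obtain \<sigma> \<tau> \<sigma>' \<tau>' where st: "s = (\<sigma>, \<tau>)" "t = (\<sigma>', \<tau>')" by fastforce
      have col: "\<sigma> \<in> colourings X" "\<tau> \<in> colourings Y" "\<sigma>' \<in> colourings X" "\<tau>' \<in> colourings Y"
        using s t by (auto simp: st)
      have "\<sigma> v = \<sigma>' v \<and> \<tau> v = \<tau>' v" if v: "v \<in> V" for v
      proof -
        have "fst (g s) v = fst (g t) v" "snd (g s) v = snd (g t) v" using eq by simp_all
        then have "colour_diff q (\<sigma> v) (\<sigma>0 v) = colour_diff q (\<sigma>' v) (\<sigma>0 v)"
          "colour_diff q (\<tau> v) (\<tau>0 v) = colour_diff q (\<tau>' v) (\<tau>0 v)"
          using v by (auto simp: g_def st split: if_splits)
        then show ?thesis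
          using colour_diff_cancel range(1)[OF col(1) v] range(1)[OF col(2) v]
            range(1)[OF col(3) v] range(1)[OF col(4) v] by blast
      qed
      moreover have "\<sigma> \<in> extensional V" "\<tau> \<in> extensional V" "\<sigma>' \<in> extensional V" "\<tau>' \<in> extensional V"
        using col by (auto simp: compatible_colourings_def potts_states_def PiE_def)
      ultimately show "s = t" unfolding st by (auto intro: extensionalityI)
    qed
    moreover have "finite ?B" by (simp add: finite_colourings)
    ultimately show ?thesis by (meson card_inj_on_le)
  qed
  have "card ?A \<le> card (boundary F \<rightarrow>\<^sub>E {1..q}) * card ?B"
  proof (rule card_le_fibre_bound[where h = h])
    show "finite ?A" by (simp add: finite_colourings)
    show "finite (boundary F \<rightarrow>\<^sub>E {1..q})" using finite_boundary by (simp add: finite_PiE)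
    show "h ` ?A \<subseteq> boundary F \<rightarrow>\<^sub>E {1..q}"
      using colour_diff_range[OF q_pos] unfolding h_def by auto
  qed (rule fibre)
  then show ?thesis using finite_boundary by (simp add: card_cartesian_product card_PiE)
qed

lemma weight_swap:
  assumes "X \<subseteq> E" "Y \<subseteq> E" "F \<subseteq> E" "card (boundary F) \<le> l"
  shows "weight X * weight Y \<le> real q ^ l * (weight (swap_on F X Y) * weight (swap_on F Y X))"
proof -
  let ?Z = "swap_on F X Y" and ?W = "swap_on F Y X"
  let ?N = "\<lambda>A. real (card (colourings A))"
  have "real (card (colourings X) * card (colourings Y))
      \<le> real (q ^ card (boundary F) * (card (colourings ?Z) * card (colourings ?W)))"
    using card_colourings_swap[OF assms(1-3)] by (rule of_nat_mono)
  then have "?N X * ?N Y \<le> real q ^ card (boundary F) * (?N ?Z * ?N ?W)" by simp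
  also have "\<dots> \<le> real q ^ l * (?N ?Z * ?N ?W)"
    using assms(4) q_pos by (intro mult_right_mono power_increasing) auto
  finally have N: "?N X * ?N Y \<le> real q ^ l * (?N ?Z * ?N ?W)" .
  have "weight X * weight Y = odds ^ (card X + card Y) * (?N X * ?N Y)"
    by (simp add: weight_def power_add)
  also have "\<dots> \<le> odds ^ (card X + card Y) * (real q ^ l * (?N ?Z * ?N ?W))"
    using odds_pos by (intro mult_left_mono N) simp
  also have "card X + card Y = card ?Z + card ?W"
    using card_swap_on[OF finite_config finite_config] assms by simp
  finally show ?thesis by (simp add: weight_def power_add mult_ac)
qed

section \<open>The Poincare inequality for the single-bond dynamics\<close>

abbreviation total_weight :: real where
  "total_weight \<equiv> \<Sum>A\<in>rc_states E. weight A"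

text \<open>Marginal bounds for one edge under the random-cluster measure, from detailed balance of the
  pairs \<open>A\<close>, \<open>insert e A\<close>.\<close>

lemma weight_open_closed:
  assumes "e \<in> E"
  shows "(\<Sum>A | A \<in> rc_states E \<and> e \<in> A. weight A) \<le> p * total_weight" (is "?in \<le> _")
    and "(\<Sum>A | A \<in> rc_states E \<and> e \<notin> A. weight A) \<le> real q * (1 - p) * total_weight" (is "?out \<le> _")
proof -
  have total: "total_weight = ?in + ?out"
    using sum.Int_Diff[OF finite_rc_states, of weight "{A. e \<in> A}"]
    by (simp add: Collect_conj_eq Int_commute set_diff_eq)
  have reindex: "?in = (\<Sum>A | A \<in> rc_states E \<and> e \<notin> A. weight (insert e A))"
    by (rule sum.reindex_bij_witness[where i = "insert e" and j = "\<lambda>A. A - {e}"])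
      (use assms in \<open>auto simp: rc_states_def insert_absorb\<close>)
  have bal: "weight (insert e A) * (1 - p) = weight A * open_prob e A" "0 \<le> weight A"
    if "A \<in> {A. A \<in> rc_states E \<and> e \<notin> A}" for A
    using that weight_insert[of A e] assms weight_pos[of A] by (auto simp: rc_states_def)
  have le: "?in * (1 - p) \<le> p * ?out"
    unfolding reindex sum_distrib_right sum_distrib_left
  proof (rule sum_mono)
    fix A assume A: "A \<in> {A. A \<in> rc_states E \<and> e \<notin> A}"
    show "weight (insert e A) * (1 - p) \<le> p * weight A"
      unfolding bal(1)[OF A] using mult_left_mono[OF open_prob_bounds(2) bal(2)[OF A]]
      by (simp add: mult.commute)
  qed
  have ge: "p / real q * ?out \<le> ?in * (1 - p)"
    unfolding reindex sum_distrib_right sum_distrib_left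
  proof (rule sum_mono)
    fix A assume A: "A \<in> {A. A \<in> rc_states E \<and> e \<notin> A}"
    show "p / real q * weight A \<le> weight (insert e A) * (1 - p)"
      unfolding bal(1)[OF A] using mult_left_mono[OF open_prob_bounds(1) bal(2)[OF A]]
      by (simp add: mult.commute)
  qed
  show "?in \<le> p * total_weight" using le unfolding total by (simp add: algebra_simps)
  have "p * ?out \<le> real q * (?in * (1 - p))"
    using ge q_pos by (simp add: field_simps)
  moreover have "(1 - p) * ?out \<le> real q * ((1 - p) * ?out)"
  proof -
    have "0 \<le> (1 - p) * ?out"
      using p_less_1 bal(2) by (intro mult_nonneg_nonneg sum_nonneg) auto
    then show ?thesis using mult_right_mono[of 1 "real q"] q_pos by simp
  qed
  ultimately show "?out \<le> real q * (1 - p) * total_weight"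
    unfolding total by (simp add: algebra_simps)
qed

text \<open>The state of \<open>e\<close> in an independent random-cluster configuration \<open>W\<close> differs from that in \<open>Z\<close> with at
  most \<open>q\<close> times the probability that an update of \<open>e\<close> changes \<open>Z\<close>.\<close>

lemma resampled_edge_bound:
  assumes "e \<in> E" "Z \<in> rc_states E"
  shows "(\<Sum>W\<in>rc_states E. weight W * (f (swap_on {e} Z W) - f Z)\<^sup>2)
    \<le> real q * total_weight * (\<Sum>B\<in>rc_states E. update e Z B * (f Z - f B)\<^sup>2)"
proof -
  have Z: "Z \<subseteq> E" using assms(2) by (simp add: rc_states_def)
  have split: "(\<Sum>W\<in>rc_states E. weight W * (f (swap_on {e} Z W) - f Z)\<^sup>2) =
      (\<Sum>W | W \<in> rc_states E \<and> e \<in> W. weight W) * (f (insert e Z) - f Z)\<^sup>2 +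
      (\<Sum>W | W \<in> rc_states E \<and> e \<notin> W. weight W) * (f (Z - {e}) - f Z)\<^sup>2"
  proof -
    have "(\<Sum>W\<in>rc_states E. weight W * (f (swap_on {e} Z W) - f Z)\<^sup>2) =
        (\<Sum>W | W \<in> rc_states E \<and> e \<in> W. weight W * (f (swap_on {e} Z W) - f Z)\<^sup>2) +
        (\<Sum>W | W \<in> rc_states E \<and> e \<notin> W. weight W * (f (swap_on {e} Z W) - f Z)\<^sup>2)"
      using sum.Int_Diff[OF finite_rc_states, of _ "{A. e \<in> A}"]
      by (simp add: Collect_conj_eq Int_commute set_diff_eq)
    moreover have "swap_on {e} Z W = (if e \<in> W then insert e Z else Z - {e})" for W
      by (auto simp: swap_on_def)
    ultimately show ?thesis by (simp add: sum_distrib_right)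
  qed
  have update: "(\<Sum>B\<in>rc_states E. update e Z B * (f Z - f B)\<^sup>2) =
      open_prob e Z * (f Z - f (insert e Z))\<^sup>2 + (1 - open_prob e Z) * (f Z - f (Z - {e}))\<^sup>2"
    using sum_edge_update[OF Z assms(1)] by (simp add: rc_states_def)
  have total: "0 \<le> total_weight"
    using weight_pos by (intro sum_nonneg) (auto simp: rc_states_def less_imp_le)
  show ?thesis
  proof (cases "e \<in> Z")
    case True
    then have "open_prob e Z = p"
      using endpoints_connected_member[OF Z] by (simp add: open_prob_def)
    moreover have "insert e Z = Z" using True by blast
    ultimately show ?thesis
      unfolding split update
      using mult_right_mono[OF weight_open_closed(2)[OF assms(1)], of "(f (Z - {e}) - f Z)\<^sup>2"]
      by (simp add: power2_commute[of "f Z"] mult_ac)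
  next
    case False
    then have "Z - {e} = Z" by blast
    moreover have "p * total_weight \<le> real q * total_weight * open_prob e Z"
    proof -
      have "p \<le> real q * open_prob e Z"
        using open_prob_bounds(1)[of e Z] q_pos by (simp add: field_simps)
      from mult_right_mono[OF this total] show ?thesis by (simp add: mult_ac)
    qed
    then have "(\<Sum>W | W \<in> rc_states E \<and> e \<in> W. weight W) \<le> real q * total_weight * open_prob e Z"
      using weight_open_closed(1)[OF assms(1)] by linarith
    ultimately show ?thesis
      unfolding split update
      using mult_right_mono[of _ "real q * total_weight * open_prob e Z" "(f (insert e Z) - f Z)\<^sup>2"]
      by (simp add: power2_commute[of "f Z"] mult.assoc)
  qed
qed

lemma edge_orderingE:
  assumes "edge_ordering E es"
  shows "distinct es" "set es = E" "length es = card E"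
  using assms distinct_card[of es] by (auto simp: edge_ordering_def)

text \<open>The total contribution of the step across the edge with index \<open>i\<close> to all canonical paths. With \<open>Z\<close> and \<open>W\<close>
  taken after the step, the state before it is \<open>Z\<close> with \<open>e\<close> reset to its state in \<open>W\<close>.\<close>

lemma path_step_bound:
  assumes es: "edge_ordering E es" and cut: "\<And>i. i \<in> {1..card E} \<Longrightarrow> card (cut_vertices V es i) \<le> l"
    and i: "i < card E"
  shows "(\<Sum>X\<in>rc_states E. \<Sum>Y\<in>rc_states E. weight X * weight Y *
      (f (swap_on (set (take i es)) X Y) - f (swap_on (set (take (Suc i) es)) X Y))\<^sup>2)
    \<le> real q ^ (l + 1) * total_weight *
      (\<Sum>Z\<in>rc_states E. \<Sum>B\<in>rc_states E. weight Z * update (es ! i) Z B * (f Z - f B)\<^sup>2)"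
proof -
  note es_facts = edge_orderingE[OF es]
  define e where "e = es ! i"
  define F where "F = set (take (Suc i) es)"
  have e: "e \<in> E" using i es_facts by (auto simp: e_def)
  have F: "F \<subseteq> E" using es_facts(2) set_take_subset by (fastforce simp: F_def)
  have take_Suc: "set (take (Suc i) es) = insert e (set (take i es))"
    using i es_facts(3) by (simp add: e_def take_Suc_conv_app_nth)
  have "e \<notin> set (take i es)"
    using es_facts(1,3) i by (auto simp: e_def in_set_conv_nth nth_eq_iff_index_eq)
  then have F': "set (take i es) = F - {e}" "e \<in> F" using take_Suc by (auto simp: F_def)
  have "E - F = set (drop (Suc i) es)"
  proof -
    have "set (take (Suc i) es) \<union> set (drop (Suc i) es) = E"
      using es_facts(2) by (metis append_take_drop_id set_append)
    moreover have "set (take (Suc i) es) \<inter> set (drop (Suc i) es) = {}"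
      using es_facts(1) by (simp add: set_take_disj_set_drop_if_distinct)
    ultimately show ?thesis by (auto simp: F_def)
  qed
  then have "boundary F = cut_vertices V es (Suc i)"
    by (simp add: boundary_def cut_vertices_def F_def)
  then have boundary: "card (boundary F) \<le> l" using cut[of "Suc i"] i by simp
  define d where "d = (\<lambda>(Z, W). (f (swap_on {e} Z W) - f Z)\<^sup>2)"
  have step: "(f (swap_on (F - {e}) X Y) - f (swap_on F X Y))\<^sup>2 = d (swap_on F X Y, swap_on F Y X)"
    for X Y
  proof -
    have "swap_on {e} (swap_on F X Y) (swap_on F Y X) = swap_on (F - {e}) X Y"
      using F'(2) by (auto simp: swap_on_def)
    then show ?thesis by (simp add: d_def)
  qed
  let ?S = "rc_states E \<times> rc_states E"
  have swap_mem: "swap_on F X Y \<in> rc_states E" if "X \<in> rc_states E" "Y \<in> rc_states E" for X Y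
    using that swap_on_subset unfolding rc_states_def by (metis Pow_iff)
  have "(\<Sum>X\<in>rc_states E. \<Sum>Y\<in>rc_states E. weight X * weight Y *
      (f (swap_on (set (take i es)) X Y) - f (swap_on (set (take (Suc i) es)) X Y))\<^sup>2) =
      (\<Sum>(X, Y)\<in>?S. weight X * weight Y * d (swap_on F X Y, swap_on F Y X))"
    unfolding F'(1) F_def[symmetric] step by (simp add: sum.cartesian_product)
  also have "\<dots> \<le> (\<Sum>(X, Y)\<in>?S. real q ^ l * (weight (swap_on F X Y) * weight (swap_on F Y X))
      * d (swap_on F X Y, swap_on F Y X))"
  proof (rule sum_mono, clarify)
    fix X Y assume "X \<in> rc_states E" "Y \<in> rc_states E"
    then show "weight X * weight Y * d (swap_on F X Y, swap_on F Y X) \<le>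
        real q ^ l * (weight (swap_on F X Y) * weight (swap_on F Y X)) * d (swap_on F X Y, swap_on F Y X)"
      using weight_swap[OF _ _ F boundary]
      by (intro mult_right_mono) (auto simp: rc_states_def d_def)
  qed
  also have "\<dots> = (\<Sum>(Z, W)\<in>?S. real q ^ l * (weight Z * weight W) * d (Z, W))"
    by (rule sum.reindex_bij_witness[where i = "\<lambda>(X, Y). (swap_on F X Y, swap_on F Y X)"
          and j = "\<lambda>(X, Y). (swap_on F X Y, swap_on F Y X)"])
      (use swap_mem in \<open>auto simp: swap_on_involution\<close>)
  also have "\<dots> = real q ^ l * (\<Sum>Z\<in>rc_states E. weight Z *
      (\<Sum>W\<in>rc_states E. weight W * (f (swap_on {e} Z W) - f Z)\<^sup>2))"
    by (simp add: sum.cartesian_product[symmetric] sum_distrib_left d_def mult_ac)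
  also have "\<dots> \<le> real q ^ l * (\<Sum>Z\<in>rc_states E. weight Z *
      (real q * total_weight * (\<Sum>B\<in>rc_states E. update e Z B * (f Z - f B)\<^sup>2)))"
    using weight_pos
    by (intro mult_left_mono sum_mono resampled_edge_bound e) (auto simp: rc_states_def less_imp_le)
  also have "\<dots> = real q ^ (l + 1) * total_weight *
      (\<Sum>Z\<in>rc_states E. \<Sum>B\<in>rc_states E. weight Z * update e Z B * (f Z - f B)\<^sup>2)"
  proof -
    have "weight Z * (real q * t * (\<Sum>B\<in>rc_states E. update e Z B * (f Z - f B)\<^sup>2)) =
        real q * t * (\<Sum>B\<in>rc_states E. weight Z * update e Z B * (f Z - f B)\<^sup>2)" for Z t
      by (simp add: sum_distrib_left mult_ac)
    then have "(\<Sum>Z\<in>rc_states E. weight Z * (real q * total_weight *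
        (\<Sum>B\<in>rc_states E. update e Z B * (f Z - f B)\<^sup>2))) = real q * total_weight *
        (\<Sum>Z\<in>rc_states E. \<Sum>B\<in>rc_states E. weight Z * update e Z B * (f Z - f B)\<^sup>2)"
      by (simp only: sum_distrib_left[symmetric])
    then show ?thesis by simp
  qed
  finally show ?thesis unfolding e_def .
qed

lemma path_bound:
  assumes es: "edge_ordering E es"
    and "X \<in> rc_states E" "Y \<in> rc_states E"
  shows "(f X - f Y)\<^sup>2 \<le> real (card E) * (\<Sum>i<card E.
    (f (swap_on (set (take i es)) X Y) - f (swap_on (set (take (Suc i) es)) X Y))\<^sup>2)"
proof -
  define g where "g = (\<lambda>i. f (swap_on (set (take i es)) X Y))"
  have "swap_on (set (take 0 es)) X Y = X" by (simp add: swap_on_def)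
  moreover have "swap_on (set (take (card E) es)) X Y = Y"
    using assms edge_orderingE[OF es] by (auto simp: swap_on_def rc_states_def)
  ultimately have "(f X - f Y)\<^sup>2 = (\<Sum>i<card E. 1 * (g i - g (Suc i)))\<^sup>2"
    using sum_lessThan_telescope'[of g "card E"] by (simp add: g_def)
  also have "\<dots> \<le> (\<Sum>i<card E. 1) * (\<Sum>i<card E. 1 * (g i - g (Suc i))\<^sup>2)"
    by (rule weighted_cauchy_schwarz) simp
  finally show ?thesis by (simp add: g_def)
qed

lemma poincare_single_bond:
  assumes "E \<noteq> {}" and es: "edge_ordering E es"
    and cut: "\<And>i. i \<in> {1..card E} \<Longrightarrow> card (cut_vertices V es i) \<le> l"
    and f: "rc_inner (\<lambda>_. 1) f = 0"
  shows "rc_inner f f \<le> 2 * (real (card E))\<^sup>2 * real q ^ (l + 1) *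
    (rc_inner f f - rc_inner f (rc_apply SB f))"
proof -
  let ?S = "rc_states E" and ?m = "real (card E)"
  define D where "D = (\<lambda>e. rc_inner f f - rc_inner f (rc_apply (update e) f))"
  have m: "0 < ?m" using assms(1) finite_E by (simp add: card_gt_0_iff)
  have total: "0 < total_weight"
    using weight_pos by (intro sum_pos finite_rc_states) (auto simp: rc_states_def)
  have D: "(\<Sum>Z\<in>?S. \<Sum>B\<in>?S. weight Z * update e Z B * (f Z - f B)\<^sup>2) = 2 * D e" if "e \<in> E" for e
    using reversible_kernel.dirichlet_form[OF update_kernel[OF that], of f] by (simp add: D_def)
  have variance: "2 * total_weight * rc_inner f f = (\<Sum>X\<in>?S. \<Sum>Y\<in>?S. weight X * weight Y * (f X - f Y)\<^sup>2)"
  proof -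
    have "(\<Sum>X\<in>?S. \<Sum>Y\<in>?S. weight X * weight Y * (f X - f Y)\<^sup>2) = (\<Sum>X\<in>?S. \<Sum>Y\<in>?S.
        (weight X * f X * f X) * weight Y + weight X * (weight Y * f Y * f Y)
        - 2 * ((weight X * f X) * (weight Y * f Y)))"
      by (intro sum.cong refl) (simp add: power2_eq_square algebra_simps)
    also have "\<dots> = rc_inner f f * total_weight + total_weight * rc_inner f f
        - 2 * (rc_inner (\<lambda>_. 1) f * rc_inner (\<lambda>_. 1) f)"
      by (simp add: sum.distrib sum_subtractf weighted_inner_def sum_product
          flip: sum_distrib_left)
    finally show ?thesis using f by simp
  qed
  also have "\<dots> \<le> (\<Sum>X\<in>?S. \<Sum>Y\<in>?S. weight X * weight Y * (?m * (\<Sum>i<card E.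
      (f (swap_on (set (take i es)) X Y) - f (swap_on (set (take (Suc i) es)) X Y))\<^sup>2)))"
    using weight_pos
    by (intro sum_mono mult_left_mono path_bound[OF es]) (auto simp: rc_states_def less_imp_le)
  also have "\<dots> = ?m * (\<Sum>X\<in>?S. \<Sum>Y\<in>?S. \<Sum>i<card E. weight X * weight Y *
      (f (swap_on (set (take i es)) X Y) - f (swap_on (set (take (Suc i) es)) X Y))\<^sup>2)"
    by (simp add: sum_distrib_left mult_ac)
  also have "(\<Sum>X\<in>?S. \<Sum>Y\<in>?S. \<Sum>i<card E. weight X * weight Y *
      (f (swap_on (set (take i es)) X Y) - f (swap_on (set (take (Suc i) es)) X Y))\<^sup>2) =
      (\<Sum>i<card E. \<Sum>X\<in>?S. \<Sum>Y\<in>?S. weight X * weight Y *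
      (f (swap_on (set (take i es)) X Y) - f (swap_on (set (take (Suc i) es)) X Y))\<^sup>2)"
    unfolding sum.swap[of _ "{..<card E}" ?S] ..
  also have "?m * \<dots> \<le> ?m * (\<Sum>i<card E. real q ^ (l + 1) * total_weight * (2 * D (es ! i)))"
  proof (intro mult_left_mono sum_mono)
    fix i assume "i \<in> {..<card E}"
    then have i: "i < card E" "es ! i \<in> E" using edge_orderingE[OF es] by auto
    show "(\<Sum>X\<in>?S. \<Sum>Y\<in>?S. weight X * weight Y *
        (f (swap_on (set (take i es)) X Y) - f (swap_on (set (take (Suc i) es)) X Y))\<^sup>2)
        \<le> real q ^ (l + 1) * total_weight * (2 * D (es ! i))"
      using path_step_bound[OF es cut i(1), of f] unfolding D[OF i(2)] .
  qed simp
  also have "\<dots> = ?m * (real q ^ (l + 1) * total_weight * 2 * (\<Sum>e\<in>E. D e))"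
  proof -
    have "(\<Sum>i<card E. D (es ! i)) = (\<Sum>e\<in>E. D e)"
      using edge_orderingE[OF es] by (intro sum.reindex_bij_betw bij_betw_nth) auto
    then show ?thesis by (simp add: sum_distrib_left[symmetric] mult.assoc)
  qed
  also have "(\<Sum>e\<in>E. D e) = 2 * ?m * (rc_inner f f - rc_inner f (rc_apply SB f))"
    using m by (simp add: D_def inner_SB sum_subtractf field_simps)
  finally have "total_weight * (2 * rc_inner f f) \<le> total_weight *
      (2 * (2 * ?m\<^sup>2 * real q ^ (l + 1) * (rc_inner f f - rc_inner f (rc_apply SB f))))"
    by (simp add: power2_eq_square algebra_simps)
  then show ?thesis using total by (simp only: mult_le_cancel_left_pos)
qed

end

section \<open>Comparison of the gaps\<close>

text \<open>The minimum in the definition of the linear width is attained, since every ordering has cuts of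
  size at most \<open>|V|\<close>.\<close>

lemma linear_width_ordering:
  assumes "finite_graph V E"
  obtains es where "edge_ordering E es"
    "\<And>i. i \<in> {1..card E} \<Longrightarrow> card (cut_vertices V es i) \<le> linear_width V E"
proof -
  have V: "finite V" using assms by (simp add: finite_graph_def)
  have "E \<subseteq> Pow V" using assms by (auto simp: finite_graph_def)
  then have "finite E" using V finite_subset by blast
  then obtain es where es: "set es = E" "distinct es" using finite_distinct_list by blast
  have "card (cut_vertices V es i) \<le> card V" for i
    using V by (intro card_mono) (auto simp: cut_vertices_def)
  then have "\<exists>l es. edge_ordering E es \<and> (\<forall>i\<in>{1..card E}. card (cut_vertices V es i) \<le> l)"
    using es unfolding edge_ordering_def by blast
  from LeastI_ex[OF this, folded linear_width_def] obtain es where "edge_ordering E es"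
    "\<forall>i\<in>{1..card E}. card (cut_vertices V es i) \<le> linear_width V E"
    by blast
  then show ?thesis by (intro that) blast+
qed

theorem corollary8:
  fixes V :: "'v set" and E :: "'v set set" and p :: real and q l :: nat
  assumes "finite_graph V E"
    and "E \<noteq> {}"
    and "linear_width V E \<le> l"
    and "0 < p" and "p < 1"
    and "q \<ge> 1"
  shows "inverse_gap (rc_states E) (swendsen_wang V E p q)
           \<le> inverse_gap (rc_states E) (single_bond V E p q)
       \<and> inverse_gap (rc_states E) (single_bond V E p q)
           \<le> ereal (4 * real (card E) ^ 2 * real q ^ (l + 1))"
proof -
  interpret random_cluster V E p q using assms by unfold_locales auto
  interpret SB: reversible_kernel "rc_states E" weight SB using SB_kernel assms(2) .
  interpret SW: reversible_kernel "rc_states E" weight SW by (rule SW_kernel)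
  obtain es where es: "edge_ordering E es"
    and cut: "\<And>i. i \<in> {1..card E} \<Longrightarrow> card (cut_vertices V es i) \<le> linear_width V E"
    by (rule linear_width_ordering[OF assms(1)]) (rule that; assumption)
  have cut_l: "card (cut_vertices V es i) \<le> l" if "i \<in> {1..card E}" for i
    using cut[OF that] assms(3) by linarith
  \<comment> \<open>The constant of the Poincare inequality is half of the claimed bound.\<close>
  define C where "C = 2 * (real (card E))\<^sup>2 * real q ^ (l + 1)"
  have "0 < card E" using assms(2) finite_E by (simp add: card_gt_0_iff)
  then have C: "0 < C" using q_pos by (simp add: C_def)
  have two_states: "{} \<in> rc_states E" "E \<in> rc_states E" "{} \<noteq> E"
    using assms(2) by (auto simp: rc_states_def)
  have rayleigh: "rc_inner f (rc_apply SB f) \<le> (1 - 1 / C) * rc_inner f f"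
    if "rc_inner (\<lambda>_. 1) f = 0" for f
    using poincare_single_bond[OF assms(2) es cut_l that, folded C_def] C by (simp add: field_simps)
  have SB_nonneg: "0 \<le> rc_inner f (rc_apply SB f)" for f
    using inner_SW_nonneg inner_SW_le_inner_SB[OF assms(2)] by (rule order_trans)
  have inverse_C: "0 < 1 / C" using C by simp
  note SB_gap = SB.spectral_gap_rayleigh[OF two_states SB_nonneg inverse_C]
  have gap: "1 / C \<le> spectral_gap (rc_states E) SB" by (rule SB_gap(1)) (rule rayleigh)
  with inverse_C have gap_pos: "0 < spectral_gap (rc_states E) SB" by (rule less_le_trans)
  have "rc_inner f (rc_apply SW f) \<le> (1 - spectral_gap (rc_states E) SB) * rc_inner f f"
    if "rc_inner (\<lambda>_. 1) f = 0" for f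
    by (rule order_trans[OF inner_SW_le_inner_SB[OF assms(2)] SB_gap(2)[OF _ that]]) (rule rayleigh)
  then have gaps: "spectral_gap (rc_states E) SB \<le> spectral_gap (rc_states E) SW"
    by (rule SW.spectral_gap_rayleigh(1)[OF two_states inner_SW_nonneg gap_pos])
  have "inverse_gap (rc_states E) SW \<le> inverse_gap (rc_states E) SB"
    using gaps gap_pos by (simp add: inverse_gap_def le_imp_inverse_le)
  moreover have "inverse (spectral_gap (rc_states E) SB) \<le> C"
    using le_imp_inverse_le[OF gap] C by (simp add: inverse_eq_divide)
  then have "inverse (spectral_gap (rc_states E) SB) \<le> 2 * C" using C by linarith
  then have "inverse_gap (rc_states E) SB \<le> ereal (4 * real (card E) ^ 2 * real q ^ (l + 1))"
    using gap_pos by (simp add: inverse_gap_def C_def)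
  ultimately show ?thesis by blast
qed

end
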